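(* (i) Let $AN_n$ be a free abelian-by-nilpotent group of rank $n$ with basis $x_1,\ldots,x_n$, let $\widetilde{AN}_n=AN_n/\langle\langle x_1^2,\ldots,x_n^2\rangle\rangle$, and let $Y=\{y_1,\ldots,y_n\}$ be the image of $\{x_1,\ldots,x_n\}$ in $\widetilde{AN}_n$. Then for $n\ge 2$, $$n\le \mathrm{pw}(\widetilde{AN}_n,Y)\le 3n.$$ (ii) Further, let $M_n$ be a free metabelian group of rank $n$ with basis $x_1,\ldots,x_n$, let $\widetilde M_n=M_n/\langle\langle x_1^2,\ldots,x_n^2\rangle\rangle$, and let $Y=\{y_1,\ldots,y_n\}$ be the image of $\{x_1,\ldots,x_n\}$ in $\widetilde M_n$. Then $$n\le \mathrm{pw}(\widetilde M_n,Y)\le 3n-1.$$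
   Context: Let $G$ be a group with generating set $S$. A (freely) reduced word in the alphabet $S^{\pm1}$ is a palindrome if it reads the same left-to-right and right-to-left; an element of $G$ is a palindrome (with respect to $S$) if it is represented by some palindromic word in $S^{\pm1}$. The palindromic length $l_{\mathcal P}(g)$ of $g\in G$ is the minimal $k$ such that $g$ is a product of $k$ palindromes, and the palindromic width is $\mathrm{pw}(G,S)=\sup_{g\in G} l_{\mathcal P}(g)$. Let $F_n$ be the free group of rank $n$ and $\gamma_k(F_n)$ the $k$-th term of its lower central series ($\gamma_1(F_n)=F_n$). A free abelian-by-nilpotent group of rank $n$ is a group of the form $AN_n=F_n/[\gamma_{c+1}(F_n),\gamma_{c+1}(F_n)]$ for some $c\ge 1$, i.e. the free group of rank $n$ in the variety of groups that are extensions of an abelian normal subgroup by a nilpotent group of class at most $c$. The free metabelian group of rank $n$ is $M_n=F_n/F_n''$ (the case $c=1$), where $F_n''$ is the second derived subgroup. A basis of these groups is the image of a free basis of $F_n$. $\langle\langle\cdot\rangle\rangle$ denotes normal closure. *)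

theory Defs
  imports "HOL-Algebra.Generated_Groups" "HOL-Algebra.Bij" "HOL-Library.Extended_Nat"
begin

section \<open>Words and free bases\<close>

text \<open>A letter is a pair \<open>(i, b)\<close> standing for \<open>i\<close> if \<open>b\<close> is true and for the formal inverse of
  \<open>i\<close> otherwise.\<close>

type_synonym 'i word = "('i \<times> bool) list"

definition reduced_words :: "'i set \<Rightarrow> 'i word set" where
  "reduced_words I =
     {w. fst ` set w \<subseteq> I \<and> successively (\<lambda>(i, a) (j, b). \<not> (i = j \<and> a \<noteq> b)) w}"

definition word_value :: "('a, 'b) monoid_scheme \<Rightarrow> ('i \<Rightarrow> 'a) \<Rightarrow> 'i word \<Rightarrow> 'a" where
  "word_value G x w =
     foldr (\<otimes>\<^bsub>G\<^esub>) (map (\<lambda>(i, b). if b then x i else inv\<^bsub>G\<^esub> (x i)) w) \<one>\<^bsub>G\<^esub>"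

text \<open>The family \<open>x\<close>, indexed by \<open>I\<close>, is a free basis of \<open>G\<close>: every element of \<open>G\<close> is the value of
  exactly one reduced word.\<close>

definition free_basis :: "('a, 'b) monoid_scheme \<Rightarrow> 'i set \<Rightarrow> ('i \<Rightarrow> 'a) \<Rightarrow> bool" where
  "free_basis G I x \<longleftrightarrow>
     group G \<and> x ` I \<subseteq> carrier G \<and> bij_betw (word_value G x) (reduced_words I) (carrier G)"


section \<open>Palindromic width\<close>

definition palindromes :: "('a, 'b) monoid_scheme \<Rightarrow> 'a set \<Rightarrow> 'a set" where
  "palindromes G S = {word_value G (\<lambda>s. s) w | w. w \<in> reduced_words S \<and> rev w = w}"

text \<open>The length of an element that is not a product of palindromes is \<open>\<infinity>\<close>, the infimum of the
  empty set; this does not occur when \<open>S\<close> generates \<open>G\<close>.\<close>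

definition palindromic_length :: "('a, 'b) monoid_scheme \<Rightarrow> 'a set \<Rightarrow> 'a \<Rightarrow> enat" where
  "palindromic_length G S g =
     Inf {enat (length ps) | ps. set ps \<subseteq> palindromes G S \<and> foldr (\<otimes>\<^bsub>G\<^esub>) ps \<one>\<^bsub>G\<^esub> = g}"

definition palindromic_width :: "('a, 'b) monoid_scheme \<Rightarrow> 'a set \<Rightarrow> enat" where
  "palindromic_width G S = (SUP g \<in> carrier G. palindromic_length G S g)"


section \<open>The quotients\<close>

definition commutator_subgroup ::
    "('a, 'b) monoid_scheme \<Rightarrow> 'a set \<Rightarrow> 'a set \<Rightarrow> 'a set" where
  "commutator_subgroup G H K =
     generate G {h \<otimes>\<^bsub>G\<^esub> k \<otimes>\<^bsub>G\<^esub> inv\<^bsub>G\<^esub> h \<otimes>\<^bsub>G\<^esub> inv\<^bsub>G\<^esub> k | h k. h \<in> H \<and> k \<in> K}"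

text \<open>Numbered so that \<open>lower_central G 1 = carrier G\<close>; the value at \<open>0\<close> is junk.\<close>

definition lower_central :: "('a, 'b) monoid_scheme \<Rightarrow> nat \<Rightarrow> 'a set" where
  "lower_central G k = ((\<lambda>H. commutator_subgroup G H (carrier G)) ^^ (k - 1)) (carrier G)"

definition normal_closure :: "('a, 'b) monoid_scheme \<Rightarrow> 'a set \<Rightarrow> 'a set" where
  "normal_closure G S =
     generate G {g \<otimes>\<^bsub>G\<^esub> s \<otimes>\<^bsub>G\<^esub> inv\<^bsub>G\<^esub> g | g s. g \<in> carrier G \<and> s \<in> S}"

text \<open>For \<open>F\<close> free, the kernels of the maps onto the free abelian-by-(nilpotent of class at most
  \<open>c\<close>) and onto the free metabelian quotient of \<open>F\<close>. Here \<open>derived F H\<close> is \<open>[H, H]\<close>.\<close>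

definition ab_nilp_kernel :: "('a, 'b) monoid_scheme \<Rightarrow> nat \<Rightarrow> 'a set" where
  "ab_nilp_kernel F c = derived F (lower_central F (c + 1))"

definition metab_kernel :: "('a, 'b) monoid_scheme \<Rightarrow> 'a set" where
  "metab_kernel F = derived F (derived F (carrier F))"

definition squares_closure :: "('a, 'b) monoid_scheme \<Rightarrow> 'a set \<Rightarrow> 'a set" where
  "squares_closure G X = normal_closure G ((\<lambda>x. x [^]\<^bsub>G\<^esub> (2::nat)) ` X)"

text \<open>The image of a subset of \<open>G\<close> in \<open>G Mod N\<close>.\<close>

definition coset_image :: "('a, 'b) monoid_scheme \<Rightarrow> 'a set \<Rightarrow> 'a set \<Rightarrow> 'a set set" where
  "coset_image G N X = (\<lambda>g. N #>\<^bsub>G\<^esub> g) ` X"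


section \<open>Existence of free groups\<close>

text \<open>\<open>free_basis\<close> is satisfiable for every index set. The free group is realised inside the
  permutations of the reduced words, each letter acting by left multiplication followed by free
  reduction.\<close>

definition letter_act :: "'i \<times> bool \<Rightarrow> 'i word \<Rightarrow> 'i word" where
  "letter_act l w =
     (case w of [] \<Rightarrow> [l]
      | m # v \<Rightarrow> if fst m = fst l \<and> snd m \<noteq> snd l then v else l # w)"

lemma letter_act_red: "fst l \<in> I \<Longrightarrow> w \<in> reduced_words I \<Longrightarrow> letter_act l w \<in> reduced_words I"
  by (cases w; cases "tl w") (auto simp: letter_act_def reduced_words_def successively_Cons)

lemma letter_act_inv: "w \<in> reduced_words I \<Longrightarrow> letter_act (i, b) (letter_act (i, \<not> b) w) = w"
  by (cases w; cases "tl w") (auto simp: letter_act_def reduced_words_def successively_Cons)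

lemma letter_act_Cons: "l # w \<in> reduced_words I \<Longrightarrow> letter_act l w = l # w"
  by (cases w) (auto simp: letter_act_def reduced_words_def)

lemma letter_act_Bij: assumes "i \<in> I"
  shows "restrict (letter_act (i,b)) (reduced_words I) \<in> Bij (reduced_words I)"
proof -
  have "bij_betw (letter_act (i,b)) (reduced_words I) (reduced_words I)"
    by (rule bij_betw_byWitness[where f' = "letter_act (i, \<not> b)"])
       (use assms letter_act_inv[of _ I i b] letter_act_inv[of _ I i "\<not> b"] letter_act_red[of "(i,_)" I] in auto)
  then show ?thesis by (simp add: Bij_def)
qed

lemma free_basis_exists:
  fixes I :: "'i set"
  shows "\<exists>(F :: ('i word \<Rightarrow> 'i word) monoid) x. free_basis F I x"
proof -
  define R where "R = reduced_words I"
  define B where "B = BijGroup R"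
  define a where "a = (\<lambda>l. restrict (letter_act l) R)"
  define x where "x = (\<lambda>i. a (i, True))"
  interpret B: group B unfolding B_def by (rule group_BijGroup)
  have aB: "a l \<in> carrier B" if "fst l \<in> I" for l
    using letter_act_Bij[of "fst l" I "snd l"] that by (auto simp: B_def BijGroup_def a_def R_def)
  have mult: "(f \<otimes>\<^bsub>B\<^esub> g) w = f (g w)" if "f \<in> carrier B" "g \<in> carrier B" "w \<in> R" for f g w
    using that by (auto simp: B_def BijGroup_def compose_def)
  have one: "\<one>\<^bsub>B\<^esub> = (\<lambda>w\<in>R. w)" by (simp add: B_def BijGroup_def)
  have ext: "f = g" if "f \<in> carrier B" "g \<in> carrier B" "\<And>w. w \<in> R \<Longrightarrow> f w = g w" for f g
    using that by (auto simp: B_def BijGroup_def Bij_def intro: extensionalityI)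
  have clR: "f w \<in> R" if "f \<in> carrier B" "w \<in> R" for f w
    using that by (auto simp: B_def BijGroup_def Bij_def dest: bij_betwE)
  have ainv: "a (i, b) \<otimes>\<^bsub>B\<^esub> a (i, \<not> b) = \<one>\<^bsub>B\<^esub>" if "i \<in> I" for i b
  proof (rule ext)
    fix w assume w: "w \<in> R"
    have "letter_act (i, \<not> b) w \<in> R" using letter_act_red[of "(i,\<not>b)" I w] w that by (simp add: R_def)
    then show "(a (i, b) \<otimes>\<^bsub>B\<^esub> a (i, \<not> b)) w = \<one>\<^bsub>B\<^esub> w" 
      using w that aB letter_act_inv[of w I i b] by (subst mult) (auto simp: a_def one R_def)
  qed (use aB that in auto)
  have inva: "inv\<^bsub>B\<^esub> (a (i, True)) = a (i, False)" if "i \<in> I" for i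
    using ainv[of i False] that aB by (intro B.inv_equality) auto
  have letter: "(if b then x i else inv\<^bsub>B\<^esub> (x i)) = a (i, b)" if "i \<in> I" for i b
    using inva that by (auto simp: x_def)
  define C where "C = generate B (x ` I)"
  define F where "F = B\<lparr>carrier := C\<rparr>"
  have xB: "x ` I \<subseteq> carrier B" using aB by (auto simp: x_def)
  have sub: "subgroup C B" unfolding C_def by (rule B.generate_is_subgroup[OF xB])
  interpret F: group F unfolding F_def by (rule subgroup.subgroup_is_group[OF sub B.is_group])
  have xC: "x i \<in> C" if "i \<in> I" for i using that by (auto simp: C_def intro: generate.incl)
  have aC: "a (i,b) \<in> C" if "i \<in> I" for i b
    using letter[OF that, of b] xC[OF that] subgroup.m_inv_closed[OF sub, of "x i"] by metis
  have invF: "inv\<^bsub>F\<^esub> (x i) = inv\<^bsub>B\<^esub> (x i)" if "i \<in> I" for i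
    unfolding F_def using B.m_inv_consistent[OF sub xC[OF that]] by simp
  have vC: "word_value F x (l # w) = a l \<otimes>\<^bsub>B\<^esub> word_value F x w" if "fst l \<in> I" for l w
    using letter[of "fst l" "snd l"] that invF[of "fst l"]
    by (cases l) (auto simp: word_value_def F_def)
  have vN: "word_value F x [] = \<one>\<^bsub>B\<^esub>" by (simp add: word_value_def F_def)
  have CB: "C \<subseteq> carrier B" using sub by (rule subgroup.subset)
  have val: "word_value F x w \<in> C \<and> word_value F x w [] = w" if "w \<in> R" for w
    using that
  proof (induction w)
    case Nil then show ?case using sub by (auto simp: vN one[symmetric] subgroup.one_closed R_def reduced_words_def) (simp add: one R_def reduced_words_def)
  next
    case (Cons l w)
    have w: "w \<in> R" "fst l \<in> I" using Cons.prems by (auto simp: R_def reduced_words_def successively_Cons)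
    have "[] \<in> R" by (simp add: R_def reduced_words_def)
    note IH = Cons.IH[OF w(1)]
    have "a l \<in> C" using aC[of "fst l" "snd l"] w(2) by simp
    then have "word_value F x (l # w) \<in> C"
      unfolding vC[OF w(2)] using IH subgroup.m_closed[OF sub] by blast
    moreover have "word_value F x (l # w) [] = a l (word_value F x w [])"
      unfolding vC[OF w(2)] by (rule mult) (use aB w(2) IH CB \<open>[] \<in> R\<close> in blast)+
    moreover have "a l w = l # w"
      using w(1) Cons.prems letter_act_Cons[of l w I] by (simp add: a_def R_def)
    ultimately show ?case using IH by simp
  qed
  have step: "a l \<otimes>\<^bsub>B\<^esub> word_value F x w = word_value F x (letter_act l w)" if "w \<in> R" "fst l \<in> I" for l w
  proof (cases "\<exists>v. w = (fst l, \<not> snd l) # v")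
    case True
    then obtain v where v: "w = (fst l, \<not> snd l) # v" by blast
    have vR: "v \<in> R" using that v by (auto simp: R_def reduced_words_def successively_Cons)
    have "a l \<otimes>\<^bsub>B\<^esub> word_value F x w = (a l \<otimes>\<^bsub>B\<^esub> a (fst l, \<not> snd l)) \<otimes>\<^bsub>B\<^esub> word_value F x v"
      using that aB[of l] aB[of "(fst l, \<not> snd l)"] subsetD[OF CB] val[OF vR]
      unfolding v by (simp add: vC B.m_assoc)
    also have "\<dots> = word_value F x v" using ainv[of "fst l" "snd l"] that val[OF vR] CB by auto
    finally show ?thesis using v by (auto simp: letter_act_def)
  next
    case False
    then have "letter_act l w = l # w" by (cases w) (auto simp: letter_act_def prod_eq_iff)
    then show ?thesis using vC that by simp
  qed
  have stepV: "a l \<otimes>\<^bsub>B\<^esub> g \<in> word_value F x ` R" if "g \<in> word_value F x ` R" "fst l \<in> I" for g l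
  proof -
    obtain w where w: "w \<in> R" "g = word_value F x w" using \<open>g \<in> word_value F x ` R\<close> by blast
    have "letter_act l w \<in> R" using letter_act_red[of l I w] w(1) that(2) by (simp add: R_def)
    then show ?thesis using step[OF w(1) that(2)] w(2) by blast
  qed
  have valB: "h \<in> carrier B" if "h \<in> word_value F x ` R" for h
    using that val CB by blast
  have gen: "\<forall>h \<in> word_value F x ` R. g \<otimes>\<^bsub>B\<^esub> h \<in> word_value F x ` R" if "g \<in> C" for g
    using that unfolding C_def
  proof (induction g rule: generate.induct)
    case one then show ?case by (simp add: valB)
  next
    case (incl h)
    then obtain i where "i \<in> I" "h = a (i, True)" by (auto simp: x_def)
    then show ?case using stepV[where l = "(i, True)"] by simp
  next
    case (inv h)
    then obtain i where "i \<in> I" "inv\<^bsub>B\<^esub> h = a (i, False)" using inva by (auto simp: x_def)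
    then show ?case using stepV[where l = "(i, False)"] by simp
  next
    case (eng g h)
    then have gh: "g \<in> carrier B" "h \<in> carrier B" using CB by (auto simp: C_def)
    show ?case
    proof
      fix v assume v: "v \<in> word_value F x ` R"
      then have "g \<otimes>\<^bsub>B\<^esub> (h \<otimes>\<^bsub>B\<^esub> v) \<in> word_value F x ` R" using eng.IH by blast
      then show "g \<otimes>\<^bsub>B\<^esub> h \<otimes>\<^bsub>B\<^esub> v \<in> word_value F x ` R"
        by (simp only: B.m_assoc[OF gh valB[OF v]])
    qed
  qed
  have oneV: "\<one>\<^bsub>B\<^esub> \<in> word_value F x ` R" 
    by (rule image_eqI[where x = "[]"]) (auto simp: vN R_def reduced_words_def)
  have "C \<subseteq> word_value F x ` R"
  proof
    fix g assume g: "g \<in> C"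
    then have "g \<otimes>\<^bsub>B\<^esub> \<one>\<^bsub>B\<^esub> \<in> word_value F x ` R" using gen oneV by blast
    then show "g \<in> word_value F x ` R" using g CB by (metis B.r_one subsetD)
  qed
  then have "bij_betw (word_value F x) R C"
    unfolding bij_betw_def using val by (auto intro!: inj_on_inverseI[where g = "\<lambda>f. f []"])
  moreover have "carrier F = C" by (simp add: F_def)
  ultimately have "free_basis F I x"
    using F.is_group xC by (auto simp: free_basis_def R_def)
  then show ?thesis by blast
qed

end

theory Submission
  imports Defs "HOL-Algebra.Zassenhaus"
begin

text \<open>The palindromes of a group \<open>G\<close> generated by involutions \<open>y\<^sub>1, \<dots>, y\<^sub>n\<close> are the identity and
the conjugates of the \<open>y\<^sub>i\<close>: a palindrome of odd length is \<open>v y\<^sub>i v\<^sup>-\<^sup>1\<close>, because reversing a word in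
involutions inverts it, and for the same reason one of even length is trivial. So the question is
how many conjugates of generators are needed to write an element.

At least \<open>n\<close> are needed for \<open>y\<^sub>1 \<cdots> y\<^sub>n\<close>, because a conjugate of \<open>y\<^sub>i\<close> goes to the \<open>i\<close>-th unit vector
under the parity map onto \<open>(\<int>/2)\<^sup>n\<close>. This map exists by the universal property of the free group,
and it survives in the quotients since these only kill commutators and conjugates of squares.

For the upper bound, \<open>2n\<close> conjugates suffice, in every rank and every class. The core is
\<open>derived_coset_conjugate_products\<close>: if \<open>\<gamma>\<^sub>c\<^sub>+\<^sub>1(G)\<close> is abelian, then every element of the coset
\<open>[G, G] y\<^sub>1 \<cdots> y\<^sub>n\<close> is a product of exactly \<open>n\<close> factors \<open>u\<^sub>i y\<^sub>i u\<^sub>i\<^sup>-\<^sup>1\<close>. An arbitrary \<open>g\<close> is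
congruent modulo \<open>[G, G]\<close> to \<open>y\<^sub>1 \<cdots> y\<^sub>n\<close> times a subproduct of \<open>y\<^sub>1 \<cdots> y\<^sub>n\<close>, which costs at most
\<open>n\<close> further generators.

The core is proved by successive approximation along the lower central series. Replacing the
conjugators \<open>u\<^sub>i\<close> of a product \<open>q\<close> by \<open>b\<^sub>i u\<^sub>i\<close>, with \<open>b\<^sub>i\<close> in a normal subgroup \<open>B\<close>, multiplies \<open>q\<close>
from the left by \<open>[b\<^sub>1, z\<^sub>1] \<cdots> [b\<^sub>n, z\<^sub>n]\<close>, where the conjugates \<open>z\<^sub>i\<close> of \<open>y\<^sub>i\<close> do not depend on the
\<open>b\<^sub>i\<close> (\<open>conjugate_products_perturb\<close>). If \<open>B\<close> commutes with \<open>[B, G]\<close>, then \<open>b \<mapsto> [b, z]\<close> is a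
homomorphism on \<open>B\<close>, and these products fill \<open>[B, G]\<close> as soon as the \<open>z\<^sub>i\<close> together with elements
centralising \<open>B\<close> generate \<open>G\<close> (\<open>commutator_subgroup_subset_commutator_products\<close>). They do: conjugates
of generators generate a nilpotent group, so the \<open>z\<^sub>i\<close> generate \<open>G\<close> modulo each term of the lower central
series (\<open>subgroup_eq_carrier_of_conjugates\<close>). Hence an error in \<open>[B, G]\<close> can be corrected.
With \<open>B = \<gamma>\<^sub>k(G)\<close>, modulo \<open>\<gamma>\<^sub>k\<^sub>+\<^sub>2(G)\<close>, the error is pushed from \<open>\<gamma>\<^sub>k\<^sub>+\<^sub>1(G)\<close> into
\<open>\<gamma>\<^sub>k\<^sub>+\<^sub>2(G)\<close>; the abelian group \<open>B = \<gamma>\<^sub>c\<^sub>+\<^sub>1(G)\<close> finally allows it to be removed completely.\<close>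

section \<open>Commutators and the lower central series\<close>

context group
begin

lemma inv_mult_cancel_left: "a \<in> carrier G \<Longrightarrow> b \<in> carrier G \<Longrightarrow> inv a \<otimes> (a \<otimes> b) = b"
  by (simp add: m_assoc[symmetric])

lemma mult_inv_cancel_left: "a \<in> carrier G \<Longrightarrow> b \<in> carrier G \<Longrightarrow> a \<otimes> (inv a \<otimes> b) = b"
  by (simp add: m_assoc[symmetric])

text \<open>As rewrite rules, these facts bring a product of elements and inverses into a right-bracketed,
freely reduced form and so decide identities of group words.\<close>

lemmas word_simps = m_assoc inv_mult_group inv_mult_cancel_left mult_inv_cancel_left

end

abbreviation commutator :: "('a, 'b) monoid_scheme \<Rightarrow> 'a \<Rightarrow> 'a \<Rightarrow> 'a" where
  "commutator G a b \<equiv> a \<otimes>\<^bsub>G\<^esub> b \<otimes>\<^bsub>G\<^esub> inv\<^bsub>G\<^esub> a \<otimes>\<^bsub>G\<^esub> inv\<^bsub>G\<^esub> b"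

lemma commutator_in_commutator_subgroup:
  "h \<in> H \<Longrightarrow> k \<in> K \<Longrightarrow> commutator G h k \<in> commutator_subgroup G H K"
  unfolding commutator_subgroup_def by (rule generate.incl) blast

lemma lower_central_one: "lower_central G (Suc 0) = carrier G"
  by (simp add: lower_central_def)

lemma lower_central_Suc:
  "lower_central G (Suc (Suc k)) = commutator_subgroup G (lower_central G (Suc k)) (carrier G)"
  by (simp add: lower_central_def)

lemma derived_eq_lower_central: "derived G (carrier G) = lower_central G (Suc (Suc 0))"
proof -
  have "derived_set G (carrier G) =
      {commutator G h k | h k. h \<in> carrier G \<and> k \<in> carrier G}" by blast
  then show ?thesis
    by (simp add: lower_central_Suc lower_central_one commutator_subgroup_def derived_def)
qed

context group
begin

lemma commutator_subgroup_normal: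
  assumes "B \<lhd> G"
  shows "commutator_subgroup G B (carrier G) \<lhd> G"
proof -
  have B: "B \<subseteq> carrier G" using assms normal_imp_subgroup subgroup.subset by blast
  show ?thesis
    unfolding commutator_subgroup_def
  proof (rule normal_generateI)
    fix h g assume "h \<in> {commutator G h k | h k. h \<in> B \<and> k \<in> carrier G}" and g: "g \<in> carrier G"
    then obtain b k where bk: "b \<in> B" "k \<in> carrier G" "h = commutator G b k" by blast
    have b: "b \<in> carrier G" using bk B by blast
    have "g \<otimes> h \<otimes> inv g = commutator G (g \<otimes> b \<otimes> inv g) (g \<otimes> k \<otimes> inv g)"
      using b bk g by (simp add: word_simps)
    moreover have "g \<otimes> b \<otimes> inv g \<in> B" using normal.inv_op_closed2[OF assms g bk(1)] .
    moreover have "g \<otimes> k \<otimes> inv g \<in> carrier G" using g bk by simp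
    ultimately show "g \<otimes> h \<otimes> inv g \<in> {commutator G h k | h k. h \<in> B \<and> k \<in> carrier G}" by blast
  qed (use B in auto)
qed

lemma commutator_subgroup_subset:
  assumes "B \<lhd> G"
  shows "commutator_subgroup G B (carrier G) \<subseteq> B"
  unfolding commutator_subgroup_def
proof (rule generate_subgroup_incl[OF _ normal_imp_subgroup[OF assms]], clarify)
  interpret B: normal B G by fact
  fix b k assume bk: "b \<in> B" "k \<in> carrier G"
  have "b \<otimes> (k \<otimes> inv b \<otimes> inv k) \<in> B"
    by (rule B.m_closed[OF bk(1)], rule B.inv_op_closed2) (use bk B.m_inv_closed in auto)
  then show "commutator G b k \<in> B" using bk by (simp add: m_assoc)
qed

lemma lower_central_normal: "lower_central G (Suc k) \<lhd> G"
  by (induction k) (auto simp: lower_central_one lower_central_Suc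
      intro: commutator_subgroup_normal normal_self)

lemma lower_central_in_carrier: "lower_central G (Suc k) \<subseteq> carrier G"
  using lower_central_normal normal_imp_subgroup subgroup.subset by blast

lemma lower_central_decreasing: "lower_central G (Suc (Suc k)) \<subseteq> lower_central G (Suc k)"
  unfolding lower_central_Suc by (rule commutator_subgroup_subset[OF lower_central_normal])

lemma commutator_in_lower_central:
  assumes "g \<in> carrier G" "e \<in> lower_central G (Suc k)"
  shows "commutator G g e \<in> lower_central G (Suc (Suc k))"
proof -
  have e: "e \<in> carrier G" using subsetD[OF lower_central_in_carrier assms(2)] .
  have "commutator G e g \<in> lower_central G (Suc (Suc k))"
    unfolding lower_central_Suc
    by (rule commutator_in_commutator_subgroup[OF assms(2) assms(1)])
  then have "inv (commutator G e g) \<in> lower_central G (Suc (Suc k))"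
    by (rule subgroup.m_inv_closed[OF normal_imp_subgroup[OF lower_central_normal]])
  then show ?thesis using e assms by (simp add: word_simps)
qed

end

lemma (in group_hom) commutator_subgroup_img:
  assumes "A \<subseteq> carrier G" "B \<subseteq> carrier G"
  shows "commutator_subgroup H (h ` A) (h ` B) = h ` commutator_subgroup G A B"
proof -
  have "commutator H (h a) (h b) = h (commutator G a b)" if "a \<in> A" "b \<in> B" for a b
    using that assms by (simp add: subset_iff)
  then have "(\<lambda>(a, b). commutator H (h a) (h b)) ` (A \<times> B) = (\<lambda>(a, b). h (commutator G a b)) ` (A \<times> B)"
    by (intro image_cong) auto
  then have "{commutator H a b | a b. a \<in> h ` A \<and> b \<in> h ` B} =
      h ` {commutator G a b | a b. a \<in> A \<and> b \<in> B}"
    by (simp add: set_eq_iff image_iff Bex_def) (metis (no_types))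
  moreover have "{commutator G a b | a b. a \<in> A \<and> b \<in> B} \<subseteq> carrier G"
    using subsetD[OF assms(1)] subsetD[OF assms(2)] by auto
  ultimately show ?thesis
    unfolding commutator_subgroup_def by (simp add: generate_img)
qed

lemma (in group_hom) lower_central_img:
  assumes "h ` carrier G = carrier H"
  shows "lower_central H (Suc k) = h ` lower_central G (Suc k)"
  by (induction k)
     (simp_all add: lower_central_one lower_central_Suc assms G.lower_central_in_carrier
       flip: commutator_subgroup_img)

section \<open>Generation modulo a term of the lower central series\<close>

text \<open>A commutator depends only on its arguments modulo the centre: every commutator of \<open>G = ZH\<close>,
with \<open>Z\<close> central, is already a commutator of \<open>H\<close>.\<close>

lemma (in group) commutator_central:
  assumes z: "z \<in> carrier G" "\<And>g. g \<in> carrier G \<Longrightarrow> z \<otimes> g = g \<otimes> z"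
    and z': "z' \<in> carrier G" "\<And>g. g \<in> carrier G \<Longrightarrow> z' \<otimes> g = g \<otimes> z'"
    and ab: "a \<in> carrier G" "b \<in> carrier G"
  shows "commutator G (z \<otimes> a) (z' \<otimes> b) = commutator G a b"
proof -
  have left: "commutator G (z \<otimes> a) b = commutator G a b" if "b \<in> carrier G" for b
  proof -
    have "commutator G (z \<otimes> a) b = (z \<otimes> (a \<otimes> b \<otimes> inv a)) \<otimes> (inv z \<otimes> inv b)"
      using z(1) ab that by (simp add: word_simps)
    also have "\<dots> = (a \<otimes> b \<otimes> inv a \<otimes> z) \<otimes> (inv z \<otimes> inv b)"
      using z(2)[of "a \<otimes> b \<otimes> inv a"] ab that by simp
    finally show ?thesis using z(1) ab that by (simp add: word_simps)
  qed
  have "commutator G a (z' \<otimes> b) = (a \<otimes> z') \<otimes> (b \<otimes> inv a \<otimes> inv b \<otimes> inv z')"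
    using z'(1) ab by (simp add: word_simps)
  also have "\<dots> = z' \<otimes> (a \<otimes> b \<otimes> inv a \<otimes> inv b \<otimes> inv z')"
    using z'(2)[of a, symmetric] z'(1) ab by (simp add: word_simps)
  also have "\<dots> = (a \<otimes> b \<otimes> inv a \<otimes> inv b \<otimes> inv z') \<otimes> z'"
    by (rule z'(2)) (use z' ab in simp)
  finally have "commutator G a (z' \<otimes> b) = commutator G a b"
    using z'(1) ab by (simp add: word_simps)
  then show ?thesis using left[of "z' \<otimes> b"] z'(1) ab(2) by simp
qed

lemma (in normal) rcos_eq_iff:
  assumes "a \<in> carrier G" "b \<in> carrier G"
  shows "H #> a = H #> b \<longleftrightarrow> (\<exists>d\<in>H. a = d \<otimes> b)"
proof
  assume "H #> a = H #> b"
  then have "a \<in> H #> b" using rcos_self[OF assms(1) subgroup_axioms] by simp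
  then show "\<exists>d\<in>H. a = d \<otimes> b" by (auto simp: r_coset_def)
next
  assume "\<exists>d\<in>H. a = d \<otimes> b"
  then have "a \<in> H #> b" by (auto simp: r_coset_def)
  then show "H #> a = H #> b"
    using repr_independence[OF _ assms(2) subgroup_axioms] by metis
qed

lemma (in normal) rcos_central:
  assumes e: "e \<in> carrier G" "\<And>g. g \<in> carrier G \<Longrightarrow> commutator G g e \<in> H"
    and q: "q \<in> carrier (G Mod H)"
  shows "(H #> e) \<otimes>\<^bsub>G Mod H\<^esub> q = q \<otimes>\<^bsub>G Mod H\<^esub> (H #> e)"
proof -
  obtain g where g: "g \<in> carrier G" "q = H #> g" using q by (auto simp: carrier_FactGroup)
  have "g \<otimes> e = commutator G g e \<otimes> (e \<otimes> g)" using g e(1) by (simp add: word_simps)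
  then have "H #> (g \<otimes> e) = H #> (e \<otimes> g)" using rcos_eq_iff g(1) e by blast
  then show ?thesis using g e(1) by (simp add: rcos_sum)
qed

text \<open>This is the statement that conjugates of generators generate a nilpotent group, relative to
\<open>\<gamma>\<^sub>m\<^sub>+\<^sub>1(G)\<close>. Conjugates agree modulo \<open>[G, G]\<close>, so \<open>G = \<gamma>\<^sub>2(G) H\<close>. If \<open>G = \<gamma>\<^sub>k(G) H\<close>, then every
commutator of \<open>G\<close> is congruent modulo \<open>\<gamma>\<^sub>k\<^sub>+\<^sub>1(G)\<close> to one of \<open>H\<close>, because \<open>\<gamma>\<^sub>k(G)\<close> is central there; so
\<open>\<gamma>\<^sub>2(G)\<close> and with it \<open>G\<close> lies in \<open>\<gamma>\<^sub>k\<^sub>+\<^sub>1(G) H\<close>.\<close>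

lemma (in group) subgroup_eq_carrier_of_conjugates:
  assumes H: "subgroup H G" and L: "lower_central G (Suc m) \<subseteq> H"
    and Y: "generate G Y = carrier G" and YC: "Y \<subseteq> carrier G"
    and conj: "\<And>y. y \<in> Y \<Longrightarrow> \<exists>u\<in>carrier G. u \<otimes> y \<otimes> inv u \<in> H"
  shows "H = carrier G"
proof -
  have HC: "H \<subseteq> carrier G" by (rule subgroup.subset[OF H])
  define T where "T k = lower_central G (Suc k) <#> H" for k
  have subT: "subgroup (T k) G" for k
    unfolding T_def by (rule mult_norm_subgroup[OF lower_central_normal H])
  have memT: "g \<in> T k \<longleftrightarrow> (\<exists>d\<in>lower_central G (Suc k). \<exists>h\<in>H. g = d \<otimes> h)" for g k
    by (auto simp: T_def set_mult_def)
  have HT: "H \<subseteq> T k" for k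
  proof
    fix h assume h: "h \<in> H"
    have "h = \<one> \<otimes> h" using h HC by auto
    then show "h \<in> T k"
      unfolding memT using h subgroup.one_closed[OF normal_imp_subgroup[OF lower_central_normal]]
      by blast
  qed
  have "Y \<subseteq> T (Suc 0)"
  proof
    fix y assume "y \<in> Y"
    then obtain u where u: "u \<in> carrier G" "u \<otimes> y \<otimes> inv u \<in> H" and y: "y \<in> carrier G"
      using conj YC by blast
    let ?h = "u \<otimes> y \<otimes> inv u"
    \<comment> \<open>\<open>y\<close> is the conjugate of \<open>?h \<in> H\<close> by \<open>u\<^sup>-\<^sup>1\<close>, so it differs from \<open>?h\<close> by a commutator.\<close>
    have "y = commutator G (inv u) ?h \<otimes> ?h" using u(1) y by (simp add: word_simps)
    moreover have "commutator G (inv u) ?h \<in> lower_central G (Suc (Suc 0))"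
      using u y by (intro commutator_in_lower_central) (auto simp: lower_central_one)
    ultimately show "y \<in> T (Suc 0)" using u(2) unfolding memT by blast
  qed
  then have T1: "carrier G \<subseteq> T (Suc 0)"
    using generate_subgroup_incl[OF _ subT] Y by metis
  have TS: "carrier G \<subseteq> T (Suc k)" for k
  proof (induction k)
    case 0 then show ?case by (rule T1)
  next
    case (Suc k)
    let ?D = "lower_central G (Suc (Suc (Suc k)))"
    interpret D: normal ?D G by (rule lower_central_normal)
    interpret Q: group "G Mod ?D" by (rule D.factorgroup_is_group)
    interpret \<pi>: group_hom G "G Mod ?D" "\<lambda>a. ?D #> a"
      by unfold_locales (rule D.r_coset_hom_Mod)
    let ?\<pi> = "\<lambda>a. ?D #> a"
    have comm: "commutator G a b \<in> T (Suc (Suc k))" if ab: "a \<in> carrier G" "b \<in> carrier G" for a b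
    proof -
      obtain d h where dh: "d \<in> lower_central G (Suc (Suc k))" "h \<in> H" "a = d \<otimes> h"
        using subsetD[OF Suc.IH ab(1)] unfolding memT by blast
      obtain d' h' where dh': "d' \<in> lower_central G (Suc (Suc k))" "h' \<in> H" "b = d' \<otimes> h'"
        using subsetD[OF Suc.IH ab(2)] unfolding memT by blast
      have inC: "d \<in> carrier G" "d' \<in> carrier G" "h \<in> carrier G" "h' \<in> carrier G"
        using subsetD[OF lower_central_in_carrier] dh(1,2) dh'(1,2) HC by blast+
      have central: "?\<pi> e \<otimes>\<^bsub>G Mod ?D\<^esub> q = q \<otimes>\<^bsub>G Mod ?D\<^esub> ?\<pi> e"
        if "e \<in> lower_central G (Suc (Suc k))" "q \<in> carrier (G Mod ?D)" for e q
        by (rule D.rcos_central)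
           (use that subsetD[OF lower_central_in_carrier] commutator_in_lower_central in auto)
      have "?\<pi> (commutator G a b) = commutator (G Mod ?D) (?\<pi> a) (?\<pi> b)"
        using ab by (simp del: mult_FactGroup)
      also have "\<dots> = commutator (G Mod ?D) (?\<pi> d \<otimes>\<^bsub>G Mod ?D\<^esub> ?\<pi> h) (?\<pi> d' \<otimes>\<^bsub>G Mod ?D\<^esub> ?\<pi> h')"
        using inC dh(3) dh'(3) by (simp del: mult_FactGroup)
      also have "\<dots> = commutator (G Mod ?D) (?\<pi> h) (?\<pi> h')"
        by (rule Q.commutator_central) (use central dh(1) dh'(1) inC in \<open>auto simp del: mult_FactGroup\<close>)
      also have "\<dots> = ?\<pi> (commutator G h h')"
        using inC by (simp del: mult_FactGroup)
      finally obtain e where "e \<in> ?D" "commutator G a b = e \<otimes> commutator G h h'"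
        using D.rcos_eq_iff[of "commutator G a b" "commutator G h h'"] ab inC by auto
      moreover have "commutator G h h' \<in> H"
        using dh(2) dh'(2) H by (simp add: subgroup.m_closed subgroup.m_inv_closed)
      ultimately show ?thesis unfolding memT by blast
    qed
    have L2: "lower_central G (Suc (Suc 0)) \<subseteq> T (Suc (Suc k))"
      unfolding lower_central_Suc[of _ 0] lower_central_one commutator_subgroup_def
      by (rule generate_subgroup_incl[OF _ subT]) (use comm in blast)
    have "d \<otimes> h \<in> T (Suc (Suc k))" if "d \<in> lower_central G (Suc (Suc 0))" "h \<in> H" for d h
      by (rule subgroup.m_closed[OF subT]) (use that subsetD[OF HT, of h] subsetD[OF L2, of d] in auto)
    then have "T (Suc 0) \<subseteq> T (Suc (Suc k))"
      unfolding subset_iff memT[of _ "Suc 0"] by blast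
    then show ?case using T1 by blast
  qed
  have "T m \<subseteq> H" unfolding subset_iff memT using L subgroup.m_closed[OF H] by blast
  moreover have "T (Suc m) \<subseteq> T m"
    unfolding T_def by (rule mono_set_mult[OF lower_central_decreasing order_refl])
  ultimately show ?thesis using TS[of m] HC by blast
qed

section \<open>Products of conjugates and products of commutators\<close>

primrec conjugate_products :: "('a, 'b) monoid_scheme \<Rightarrow> 'a list \<Rightarrow> 'a set" where
  "conjugate_products G [] = {\<one>\<^bsub>G\<^esub>}"
| "conjugate_products G (y # ys) =
     {(u \<otimes>\<^bsub>G\<^esub> y \<otimes>\<^bsub>G\<^esub> inv\<^bsub>G\<^esub> u) \<otimes>\<^bsub>G\<^esub> q | u q. u \<in> carrier G \<and> q \<in> conjugate_products G ys}"

primrec commutator_products :: "('a, 'b) monoid_scheme \<Rightarrow> 'a set \<Rightarrow> 'a list \<Rightarrow> 'a set" where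
  "commutator_products G B [] = {\<one>\<^bsub>G\<^esub>}"
| "commutator_products G B (z # zs) =
     {commutator G b z \<otimes>\<^bsub>G\<^esub> s | b s. b \<in> B \<and> s \<in> commutator_products G B zs}"

lemma conjugate_products_ConsI:
  "u \<in> carrier G \<Longrightarrow> q \<in> conjugate_products G ys \<Longrightarrow>
     (u \<otimes>\<^bsub>G\<^esub> y \<otimes>\<^bsub>G\<^esub> inv\<^bsub>G\<^esub> u) \<otimes>\<^bsub>G\<^esub> q \<in> conjugate_products G (y # ys)"
  by auto

lemma commutator_products_ConsI:
  "b \<in> B \<Longrightarrow> s \<in> commutator_products G B zs \<Longrightarrow>
     commutator G b z \<otimes>\<^bsub>G\<^esub> s \<in> commutator_products G B (z # zs)"
  by auto

lemma (in group) conjugate_products_in_carrier: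
  "set ys \<subseteq> carrier G \<Longrightarrow> conjugate_products G ys \<subseteq> carrier G"
  by (induction ys) auto

lemma (in group) commutator_products_in_carrier:
  "set zs \<subseteq> carrier G \<Longrightarrow> B \<subseteq> carrier G \<Longrightarrow> commutator_products G B zs \<subseteq> carrier G"
proof (induction zs)
  case (Cons z zs)
  have "commutator G b z \<otimes> s \<in> carrier G" if "b \<in> B" "s \<in> commutator_products G B zs" for b s
  proof -
    have "b \<in> carrier G" "s \<in> carrier G" "z \<in> carrier G" using that Cons by auto
    then show ?thesis by simp
  qed
  then show ?case by auto
qed simp

lemma (in group) foldr_in_conjugate_products:
  "set ys \<subseteq> carrier G \<Longrightarrow> foldr (\<otimes>) ys \<one> \<in> conjugate_products G ys"
proof (induction ys)
  case (Cons y ys)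
  have "(\<one> \<otimes> y \<otimes> inv \<one>) \<otimes> foldr (\<otimes>) ys \<one> \<in> conjugate_products G (y # ys)"
    by (rule conjugate_products_ConsI) (use Cons in auto)
  then show ?case using Cons.prems by simp
qed simp

lemma (in group_hom) commutator_products_img:
  assumes "set zs \<subseteq> carrier G" "B \<subseteq> carrier G"
  shows "commutator_products H (h ` B) (map h zs) = h ` commutator_products G B zs"
  using assms(1)
proof (induction zs)
  case (Cons z zs)
  have z: "z \<in> carrier G" using Cons.prems by simp
  have eq: "commutator H (h b) (h z) \<otimes>\<^bsub>H\<^esub> h s = h (commutator G b z \<otimes> s)"
    if "b \<in> B" "s \<in> commutator_products G B zs" for b s
  proof -
    have "b \<in> carrier G" "s \<in> carrier G"
      using that assms(2) G.commutator_products_in_carrier[of zs B] Cons.prems by auto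
    then show ?thesis using z by simp
  qed
  have "commutator_products H (h ` B) (map h (z # zs)) =
      {commutator H (h b) (h z) \<otimes>\<^bsub>H\<^esub> h s | b s. b \<in> B \<and> s \<in> commutator_products G B zs}"
    using Cons by auto
  also have "\<dots> = {h (commutator G b z \<otimes> s) | b s. b \<in> B \<and> s \<in> commutator_products G B zs}"
    using eq by (intro Collect_cong ex_cong1) auto
  also have "\<dots> = h ` commutator_products G B (z # zs)" by auto
  finally show ?case .
qed simp

lemma (in normal) commutator_products_conj:
  assumes "set zs \<subseteq> carrier G" "p \<in> carrier G"
    and "s \<in> commutator_products G H (map (\<lambda>z. p \<otimes> z \<otimes> inv p) zs)"
  shows "\<exists>t\<in>commutator_products G H zs. s = p \<otimes> t \<otimes> inv p"
  using assms(1,3)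
proof (induction zs arbitrary: s)
  case Nil then show ?case using assms(2) by simp
next
  case (Cons z zs)
  obtain b s' where s: "b \<in> H" "s' \<in> commutator_products G H (map (\<lambda>z. p \<otimes> z \<otimes> inv p) zs)"
      "s = commutator G b (p \<otimes> z \<otimes> inv p) \<otimes> s'"
    using Cons.prems(2) by auto
  obtain t where t: "t \<in> commutator_products G H zs" "s' = p \<otimes> t \<otimes> inv p"
    using Cons.IH[OF _ s(2)] Cons.prems(1) by auto
  let ?b = "inv p \<otimes> b \<otimes> p"
  have inC: "b \<in> carrier G" "z \<in> carrier G" "t \<in> carrier G"
    using s(1) Cons.prems(1) t(1) commutator_products_in_carrier[of zs H] subset by auto
  have "s = p \<otimes> (commutator G ?b z \<otimes> t) \<otimes> inv p"
    using inC assms(2) by (simp add: s(3) t(2) word_simps)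
  moreover have "?b \<in> H" using s(1) assms(2) by (rule inv_op_closed1[rotated])
  ultimately show ?case
    by (intro bexI[of _ "commutator G ?b z \<otimes> t"] commutator_products_ConsI t(1))
qed

text \<open>The effect of changing the conjugators of \<open>q\<close> by elements of the normal subgroup. In one factor,
\<open>(bu) y (bu)\<^sup>-\<^sup>1 = [b, p] p\<close> with \<open>p = u y u\<^sup>-\<^sup>1\<close>; collecting the commutators on the left conjugates each of
them by the factors in front of it. Normality absorbs this conjugation in \<open>b\<close>, and for the second
argument it only replaces one conjugate of the generator by another.\<close>

lemma (in normal) conjugate_products_perturb:
  assumes "set ys \<subseteq> carrier G" "q \<in> conjugate_products G ys"
  shows "\<exists>zs. list_all2 (\<lambda>y z. \<exists>u\<in>carrier G. z = u \<otimes> y \<otimes> inv u) ys zs \<and>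
           (\<forall>s\<in>commutator_products G H zs. s \<otimes> q \<in> conjugate_products G ys)"
  using assms
proof (induction ys arbitrary: q)
  case Nil then show ?case by simp
next
  case (Cons y ys)
  obtain u q' where q: "u \<in> carrier G" "q' \<in> conjugate_products G ys" "q = (u \<otimes> y \<otimes> inv u) \<otimes> q'"
    using Cons.prems(2) by auto
  obtain zs where zs: "list_all2 (\<lambda>y z. \<exists>u\<in>carrier G. z = u \<otimes> y \<otimes> inv u) ys zs"
      "\<And>s. s \<in> commutator_products G H zs \<Longrightarrow> s \<otimes> q' \<in> conjugate_products G ys"
    using Cons.IH[OF _ q(2)] Cons.prems(1) by auto
  have y: "y \<in> carrier G" and ys: "set ys \<subseteq> carrier G" using Cons.prems(1) by auto
  have zsC: "set zs \<subseteq> carrier G"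
    using zs(1) ys by (induction rule: list_all2_induct) auto
  define p where "p = u \<otimes> y \<otimes> inv u"
  have p: "p \<in> carrier G" using q(1) y by (simp add: p_def)
  let ?zs = "p # map (\<lambda>z. p \<otimes> z \<otimes> inv p) zs"
  have "list_all2 (\<lambda>y z. \<exists>u\<in>carrier G. z = u \<otimes> y \<otimes> inv u) ys (map (\<lambda>z. p \<otimes> z \<otimes> inv p) zs)"
    unfolding list_all2_map2
  proof (rule list.rel_mono_strong[OF zs(1)])
    fix y z assume "y \<in> set ys" "z \<in> set zs" "\<exists>u\<in>carrier G. z = u \<otimes> y \<otimes> inv u"
    then obtain v where v: "v \<in> carrier G" "z = v \<otimes> y \<otimes> inv v" "y \<in> carrier G" using ys by blast
    then have "p \<otimes> z \<otimes> inv p = (p \<otimes> v) \<otimes> y \<otimes> inv (p \<otimes> v)" using p by (simp add: word_simps)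
    then show "\<exists>u\<in>carrier G. p \<otimes> z \<otimes> inv p = u \<otimes> y \<otimes> inv u" using v p by blast
  qed
  then have conj: "list_all2 (\<lambda>y z. \<exists>u\<in>carrier G. z = u \<otimes> y \<otimes> inv u) (y # ys) ?zs"
    using q(1) by (auto simp: p_def)
  have "s \<otimes> q \<in> conjugate_products G (y # ys)" if s: "s \<in> commutator_products G H ?zs" for s
  proof -
    obtain b s' where b: "b \<in> H" "s = commutator G b p \<otimes> s'"
        "s' \<in> commutator_products G H (map (\<lambda>z. p \<otimes> z \<otimes> inv p) zs)"
      using s by auto
    obtain t where t: "t \<in> commutator_products G H zs" "s' = p \<otimes> t \<otimes> inv p"
      using commutator_products_conj[OF zsC p b(3)] by blast
    have inC: "b \<in> carrier G" "t \<in> carrier G" "q' \<in> carrier G"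
      using b(1) t(1) commutator_products_in_carrier[OF zsC] q(2) conjugate_products_in_carrier[OF ys]
        subset by auto
    have "s \<otimes> q = (b \<otimes> p \<otimes> inv b) \<otimes> (t \<otimes> q')"
      using inC p unfolding q(3) p_def[symmetric] by (simp add: b(2) t(2) word_simps)
    also have "\<dots> = ((b \<otimes> u) \<otimes> y \<otimes> inv (b \<otimes> u)) \<otimes> (t \<otimes> q')"
      using inC q(1) y by (simp add: p_def word_simps)
    finally have eq: "s \<otimes> q = ((b \<otimes> u) \<otimes> y \<otimes> inv (b \<otimes> u)) \<otimes> (t \<otimes> q')" .
    show ?thesis unfolding eq
      by (rule conjugate_products_ConsI) (use zs(2)[OF t(1)] inC(1) q(1) in auto)
  qed
  then show ?case using conj by blast
qed

text \<open>Since \<open>H\<close> commutes with \<open>[H, G]\<close>, the map \<open>b \<mapsto> [b, g]\<close> is a homomorphism into the abelian group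
\<open>[H, G]\<close>, so the set \<open>S\<close> of products \<open>[b\<^sub>1, z\<^sub>1] \<cdots> [b\<^sub>k, z\<^sub>k]\<close> is closed under multiplication. The
elements \<open>g\<close> with \<open>[H, g] \<subseteq> S\<close> form a subgroup, which contains the \<open>z\<^sub>i\<close> and \<open>M\<close>.\<close>

lemma (in normal) commutator_subgroup_subset_commutator_products:
  assumes comm: "\<And>b e. b \<in> H \<Longrightarrow> e \<in> commutator_subgroup G H (carrier G) \<Longrightarrow> b \<otimes> e = e \<otimes> b"
    and M: "M \<subseteq> carrier G" "\<And>b m. b \<in> H \<Longrightarrow> m \<in> M \<Longrightarrow> commutator G b m = \<one>"
    and zs: "set zs \<subseteq> carrier G" and gen: "generate G (set zs \<union> M) = carrier G"
  shows "commutator_subgroup G H (carrier G) \<subseteq> commutator_products G H zs"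
proof -
  let ?E = "commutator_subgroup G H (carrier G)" and ?S = "commutator_products G H zs"
  have EH: "?E \<subseteq> H" by (rule commutator_subgroup_subset[OF normal_axioms])
  have HC: "H \<subseteq> carrier G" by (rule subset)
  have E: "subgroup ?E G"
    by (rule normal_imp_subgroup[OF commutator_subgroup_normal[OF normal_axioms]])
  have cE: "commutator G b g \<in> ?E" if "b \<in> H" "g \<in> carrier G" for b g
    by (rule commutator_in_commutator_subgroup[OF that])
  have hom: "commutator G (b \<otimes> b') g = commutator G b g \<otimes> commutator G b' g"
    if b: "b \<in> H" "b' \<in> H" "g \<in> carrier G" for b b' g
  proof -
    have inC: "b \<in> carrier G" "b' \<in> carrier G" using b HC by auto
    have "commutator G (b \<otimes> b') g = (b \<otimes> commutator G b' g) \<otimes> (g \<otimes> inv b \<otimes> inv g)"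
      using inC b(3) by (simp add: word_simps)
    also have "\<dots> = (commutator G b' g \<otimes> b) \<otimes> (g \<otimes> inv b \<otimes> inv g)"
      by (simp only: comm[OF b(1) cE[OF b(2,3)]])
    also have "\<dots> = commutator G b' g \<otimes> commutator G b g"
      using inC b(3) by (simp add: word_simps)
    also have "\<dots> = commutator G b g \<otimes> commutator G b' g"
      by (rule comm) (use cE b EH in auto)
    finally show ?thesis .
  qed
  have one: "commutator G \<one> g = \<one>" if "g \<in> carrier G" for g using that by simp
  have homi: "commutator G (inv b) g = inv (commutator G b g)" if b: "b \<in> H" "g \<in> carrier G" for b g
  proof -
    have inC: "b \<in> carrier G" using b HC by auto
    have "commutator G (inv b) g \<otimes> commutator G b g = \<one>"
      using hom[of "inv b" b g] b inC one by simp
    then show ?thesis using inC b(2) by (intro inv_equality[symmetric]) auto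
  qed
  have SE: "commutator_products G H ws \<subseteq> ?E" if "set ws \<subseteq> carrier G" for ws
    using that
  proof (induction ws)
    case Nil then show ?case using subgroup.one_closed[OF E] by simp
  next
    case (Cons w ws)
    then show ?case using cE subgroup.m_closed[OF E] by auto
  qed
  have mult: "s \<otimes> s' \<in> commutator_products G H ws"
    if "set ws \<subseteq> carrier G" "s \<in> commutator_products G H ws" "s' \<in> commutator_products G H ws" for ws s s'
    using that
  proof (induction ws arbitrary: s s')
    case Nil then show ?case by simp
  next
    case (Cons w ws)
    obtain b t where s: "b \<in> H" "t \<in> commutator_products G H ws" "s = commutator G b w \<otimes> t"
      using Cons.prems(2) by auto
    obtain b' t' where s': "b' \<in> H" "t' \<in> commutator_products G H ws" "s' = commutator G b' w \<otimes> t'"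
      using Cons.prems(3) by auto
    have w: "w \<in> carrier G" and ws: "set ws \<subseteq> carrier G" using Cons.prems(1) by auto
    have tE: "t \<in> ?E" "t' \<in> ?E" using s(2) s'(2) SE[OF ws] by auto
    have inC: "t \<in> carrier G" "t' \<in> carrier G" "commutator G b w \<in> carrier G" "commutator G b' w \<in> carrier G"
      using tE EH HC cE w s(1) s'(1) by blast+
    have "s \<otimes> s' = commutator G b w \<otimes> (t \<otimes> commutator G b' w) \<otimes> t'"
      unfolding s(3) s'(3) using inC by (simp only: m_assoc m_closed)
    also have "t \<otimes> commutator G b' w = commutator G b' w \<otimes> t"
      by (rule comm) (use tE EH cE s'(1) w in auto)
    also have "commutator G b w \<otimes> (commutator G b' w \<otimes> t) \<otimes> t' =
        (commutator G b w \<otimes> commutator G b' w) \<otimes> (t \<otimes> t')"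
      using inC by (simp only: m_assoc m_closed)
    also have "\<dots> = commutator G (b \<otimes> b') w \<otimes> (t \<otimes> t')"
      by (simp only: hom[OF s(1) s'(1) w])
    finally have eq: "s \<otimes> s' = commutator G (b \<otimes> b') w \<otimes> (t \<otimes> t')" .
    show ?case unfolding eq
      by (rule commutator_products_ConsI) (use Cons.IH[OF ws s(2) s'(2)] s(1) s'(1) in auto)
  qed
  have S1: "\<one> \<in> commutator_products G H ws" if "set ws \<subseteq> carrier G" for ws
    using that
  proof (induction ws)
    case (Cons w ws)
    have "commutator G \<one> w \<otimes> \<one> \<in> commutator_products G H (w # ws)"
      by (rule commutator_products_ConsI) (use Cons in auto)
    then show ?case using Cons.prems by simp
  qed simp
  have base: "commutator G b z \<in> commutator_products G H ws"
    if "set ws \<subseteq> carrier G" "z \<in> set ws" "b \<in> H" for ws z b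
    using that
  proof (induction ws)
    case (Cons w ws)
    have inC: "b \<in> carrier G" "w \<in> carrier G" "z \<in> carrier G" using Cons.prems HC by auto
    show ?case
    proof (cases "z = w")
      case True
      have "commutator G b w \<otimes> \<one> \<in> commutator_products G H (w # ws)"
        by (rule commutator_products_ConsI) (use S1[of ws] Cons.prems in auto)
      then show ?thesis using inC True by simp
    next
      case False
      have "commutator G \<one> w \<otimes> commutator G b z \<in> commutator_products G H (w # ws)"
        by (rule commutator_products_ConsI) (use Cons False in auto)
      then show ?thesis using inC by simp
    qed
  qed simp
  have "commutator G b g \<in> ?S" if "g \<in> generate G (set zs \<union> M)" "b \<in> H" for g b
    using that
  proof (induction g arbitrary: b rule: generate.induct)
    case one
    then show ?case using S1[OF zs] HC by auto
  next
    case (incl g)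
    then show ?case using base[OF zs] M S1[OF zs] by auto
  next
    case (inv g)
    have g: "g \<in> carrier G" and b: "b \<in> carrier G" using inv zs M(1) HC by auto
    let ?b = "inv g \<otimes> inv b \<otimes> g"
    have bH: "?b \<in> H" by (rule inv_op_closed1) (use g inv.prems in auto)
    have "commutator G b (inv g) = commutator G ?b g"
    proof -
      have "commutator G b (inv g) = inv g \<otimes> inv (commutator G b g) \<otimes> g"
        using g b by (simp add: word_simps)
      also have "\<dots> = inv g \<otimes> commutator G (inv b) g \<otimes> g"
        using homi[OF inv.prems g] by simp
      finally show ?thesis using g b by (simp add: word_simps)
    qed
    then show ?case using base[OF zs _ bH] M(2)[OF bH] S1[OF zs] inv.hyps by auto
  next
    case (eng g h)
    have inC: "g \<in> carrier G" "h \<in> carrier G" "b \<in> carrier G"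
      using eng.hyps eng.prems HC generate_in_carrier[of "set zs \<union> M"] zs M(1) by auto
    let ?e = "commutator G b h"
    have e: "?e \<in> H" "?e \<in> carrier G" using cE[OF eng.prems inC(2)] EH HC by auto
    \<comment> \<open>\<open>[b, gh] = [b, g] g[b, h]g\<^sup>-\<^sup>1\<close>, and the conjugate is again expressed by a commutator with \<open>g\<close>
      since \<open>[b, h]\<close> lies in \<open>H\<close>.\<close>
    have "commutator G b (g \<otimes> h) = commutator G b g \<otimes> inv (commutator G ?e g) \<otimes> ?e"
      using inC by (simp add: word_simps)
    also have "\<dots> = commutator G b g \<otimes> commutator G (inv ?e) g \<otimes> ?e"
      by (simp only: homi[OF e(1) inC(1)])
    finally have eq: "commutator G b (g \<otimes> h) = commutator G b g \<otimes> commutator G (inv ?e) g \<otimes> ?e" .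
    show ?case unfolding eq
      by (intro mult[OF zs] eng.IH) (use eng.prems e in auto)
  qed
  then have cS: "commutator G b g \<in> ?S" if "b \<in> H" "g \<in> carrier G" for b g
    using that gen by simp
  show ?thesis
  proof
    fix e assume "e \<in> ?E"
    then show "e \<in> ?S" unfolding commutator_subgroup_def
    proof (induction e rule: generate.induct)
      case one then show ?case by (rule S1[OF zs])
    next
      case (incl e) then show ?case using cS by auto
    next
      case (inv e)
      then obtain b g where bg: "b \<in> H" "g \<in> carrier G" "e = commutator G b g" by blast
      then have "inv e = commutator G (inv b) g" by (simp only: homi)
      then show ?case using cS[of "inv b" g] bg by simp
    next
      case (eng e e') then show ?case by (intro mult[OF zs])
    qed
  qed
qed

section \<open>Approximation along the lower central series\<close>

text \<open>One correction step: an error in \<open>[B, G]\<close> is traded for an error in \<open>D\<close>. In \<open>G / D\<close> the image of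
\<open>B\<close> commutes with that of \<open>[B, G]\<close> and is centralised by that of \<open>\<gamma>\<^sub>m\<^sub>+\<^sub>1(G)\<close>, which is what the
filling of \<open>[B, G]\<close> by products of commutators requires.\<close>

lemma (in group) conjugate_products_step:
  assumes B: "B \<lhd> G" and D: "D \<lhd> G"
    and BE: "\<And>b e. b \<in> B \<Longrightarrow> e \<in> commutator_subgroup G B (carrier G) \<Longrightarrow> commutator G b e \<in> D"
    and BL: "\<And>b e. b \<in> B \<Longrightarrow> e \<in> lower_central G (Suc m) \<Longrightarrow> commutator G b e \<in> D"
    and ys: "generate G (set ys) = carrier G" "set ys \<subseteq> carrier G"
    and q: "q \<in> conjugate_products G ys" and e: "e \<in> commutator_subgroup G B (carrier G)"
  shows "\<exists>d\<in>D. \<exists>q'\<in>conjugate_products G ys. e \<otimes> q = d \<otimes> q'"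
proof -
  interpret B: normal B G by fact
  interpret D: normal D G by fact
  let ?Q = "G Mod D" and ?\<pi> = "\<lambda>a. D #> a"
  interpret Q: group ?Q by (rule D.factorgroup_is_group)
  interpret \<pi>: group_hom G ?Q ?\<pi>
    by unfold_locales (rule D.r_coset_hom_Mod)
  have img: "?\<pi> ` carrier G = carrier ?Q" by (simp add: carrier_FactGroup)
  obtain zs where zs: "list_all2 (\<lambda>y z. \<exists>u\<in>carrier G. z = u \<otimes> y \<otimes> inv u) ys zs"
      "\<And>s. s \<in> commutator_products G B zs \<Longrightarrow> s \<otimes> q \<in> conjugate_products G ys"
    using B.conjugate_products_perturb[OF ys(2) q] by blast
  have zsC: "set zs \<subseteq> carrier G"
    using zs(1) ys(2) by (induction rule: list_all2_induct) auto
  let ?L = "lower_central G (Suc m)"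
  have LC: "?L \<subseteq> carrier G" by (rule lower_central_in_carrier)
  have gen: "generate G (set zs \<union> ?L) = carrier G"
  proof (rule subgroup_eq_carrier_of_conjugates[OF _ _ ys])
    show "subgroup (generate G (set zs \<union> ?L)) G"
      using zsC LC by (intro generate_is_subgroup) simp
    show "?L \<subseteq> generate G (set zs \<union> ?L)" by (auto intro: generate.incl)
    fix y assume "y \<in> set ys"
    with zs(1) have "\<exists>z\<in>set zs. \<exists>u\<in>carrier G. z = u \<otimes> y \<otimes> inv u"
      by (induction rule: list_all2_induct) auto
    then show "\<exists>u\<in>carrier G. u \<otimes> y \<otimes> inv u \<in> generate G (set zs \<union> ?L)"
      by (auto intro!: generate.incl)
  qed
  have EC: "commutator_subgroup G B (carrier G) \<subseteq> carrier G"
    using commutator_subgroup_subset[OF B] B.subset by blast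
  have com: "?\<pi> b \<otimes>\<^bsub>?Q\<^esub> ?\<pi> e = ?\<pi> e \<otimes>\<^bsub>?Q\<^esub> ?\<pi> b"
    if be: "b \<in> carrier G" "e \<in> carrier G" "commutator G b e \<in> D" for b e
  proof -
    have "b \<otimes> e = commutator G b e \<otimes> (e \<otimes> b)" using be by (simp add: word_simps)
    then have "\<exists>d\<in>D. b \<otimes> e = d \<otimes> (e \<otimes> b)" using be(3) by (rule bexI)
    then have "?\<pi> (b \<otimes> e) = ?\<pi> (e \<otimes> b)"
      by (rule D.rcos_eq_iff[THEN iffD2, rotated 2]) (use be(1,2) in simp_all)
    then show ?thesis using \<pi>.hom_mult[OF be(1,2)] \<pi>.hom_mult[OF be(2,1)] by argo
  qed
  have Eimg: "commutator_subgroup ?Q (?\<pi> ` B) (carrier ?Q) = ?\<pi> ` commutator_subgroup G B (carrier G)"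
    unfolding img[symmetric] by (rule \<pi>.commutator_subgroup_img[OF B.subset order_refl])
  interpret QB: normal "?\<pi> ` B" ?Q
  proof (rule Q.normal_invI)
    show "subgroup (?\<pi> ` B) ?Q" by (rule \<pi>.subgroup_img_is_subgroup[OF B.subgroup_axioms])
    fix x h assume "x \<in> carrier ?Q" "h \<in> ?\<pi> ` B"
    then obtain g b where gb: "g \<in> carrier G" "x = ?\<pi> g" "b \<in> B" "h = ?\<pi> b"
      unfolding img[symmetric] by blast
    have "b \<in> carrier G" using gb(3) B.subset by blast
    then have "x \<otimes>\<^bsub>?Q\<^esub> h \<otimes>\<^bsub>?Q\<^esub> inv\<^bsub>?Q\<^esub> x = ?\<pi> (g \<otimes> b \<otimes> inv g)"
      using gb by (simp del: mult_FactGroup)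
    then show "x \<otimes>\<^bsub>?Q\<^esub> h \<otimes>\<^bsub>?Q\<^esub> inv\<^bsub>?Q\<^esub> x \<in> ?\<pi> ` B"
      using B.inv_op_closed2[OF gb(1,3)] by blast
  qed
  have "commutator_subgroup ?Q (?\<pi> ` B) (carrier ?Q) \<subseteq> commutator_products ?Q (?\<pi> ` B) (map ?\<pi> zs)"
  proof (rule QB.commutator_subgroup_subset_commutator_products[where M = "?\<pi> ` ?L"])
    fix b e assume "b \<in> ?\<pi> ` B" "e \<in> commutator_subgroup ?Q (?\<pi> ` B) (carrier ?Q)"
    then show "b \<otimes>\<^bsub>?Q\<^esub> e = e \<otimes>\<^bsub>?Q\<^esub> b"
      unfolding Eimg using com BE B.subset EC by blast
  next
    fix b e assume "b \<in> ?\<pi> ` B" "e \<in> ?\<pi> ` ?L"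
    then obtain b' e' where be: "b' \<in> B" "e' \<in> ?L" "b = ?\<pi> b'" "e = ?\<pi> e'" by blast
    have inC: "b' \<in> carrier G" "e' \<in> carrier G" using be B.subset LC by auto
    have "commutator ?Q b e = ?\<pi> (commutator G b' e')"
      using inC be by (simp del: mult_FactGroup)
    also have "\<dots> = \<one>\<^bsub>?Q\<^esub>"
      using BL[OF be(1,2)] D.rcos_const by simp
    finally show "commutator ?Q b e = \<one>\<^bsub>?Q\<^esub>" .
  next
    show "?\<pi> ` ?L \<subseteq> carrier ?Q" using LC img by blast
    show "set (map ?\<pi> zs) \<subseteq> carrier ?Q" using zsC img by auto
    have "set (map ?\<pi> zs) \<union> ?\<pi> ` ?L = ?\<pi> ` (set zs \<union> ?L)" by auto
    then show "generate ?Q (set (map ?\<pi> zs) \<union> ?\<pi> ` ?L) = carrier ?Q"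
      using \<pi>.generate_img[of "set zs \<union> ?L"] zsC LC gen img by simp
  qed
  then have "?\<pi> e \<in> ?\<pi> ` commutator_products G B zs"
    unfolding Eimg \<pi>.commutator_products_img[OF zsC B.subset] using e by blast
  then obtain s where s: "s \<in> commutator_products G B zs" "?\<pi> e = ?\<pi> s" by blast
  have inC: "s \<in> carrier G" "e \<in> carrier G" "q \<in> carrier G"
    using s(1) commutator_products_in_carrier[OF zsC B.subset] e EC
      conjugate_products_in_carrier[OF ys(2)] q by blast+
  obtain d where d: "d \<in> D" "e = d \<otimes> s" using D.rcos_eq_iff[OF inC(2,1)] s(2) by blast
  have "d \<in> carrier G" using d(1) D.subset by blast
  then have "e \<otimes> q = d \<otimes> (s \<otimes> q)" using inC d(2) by (simp add: m_assoc)
  then show ?thesis using d(1) zs(2)[OF s(1)] by blast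
qed

text \<open>The induction starts with \<open>y\<^sub>1 \<cdots> y\<^sub>n\<close> itself, whose error is \<open>g \<in> \<gamma>\<^sub>2(G)\<close>. The step with
\<open>B = \<gamma>\<^sub>k(G)\<close> works because \<open>[B, \<gamma>\<^sub>k\<^sub>+\<^sub>1(G)] \<subseteq> \<gamma>\<^sub>k\<^sub>+\<^sub>2(G)\<close>, which provides both hypotheses
on commutators; the last step takes \<open>B = \<gamma>\<^sub>c\<^sub>+\<^sub>1(G)\<close>, which commutes with itself.\<close>

theorem (in group) derived_coset_conjugate_products:
  assumes ys: "generate G (set ys) = carrier G" "set ys \<subseteq> carrier G"
    and abelian: "\<And>a b. a \<in> lower_central G (Suc c) \<Longrightarrow> b \<in> lower_central G (Suc c) \<Longrightarrow> a \<otimes> b = b \<otimes> a"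
    and g: "g \<in> derived G (carrier G)"
  shows "g \<otimes> foldr (\<otimes>) ys \<one> \<in> conjugate_products G ys"
proof -
  let ?p = "foldr (\<otimes>) ys \<one>"
  have mod_lower: "\<exists>d\<in>lower_central G (Suc (Suc k)). \<exists>q\<in>conjugate_products G ys. g \<otimes> ?p = d \<otimes> q" for k
  proof (induction k)
    case 0
    then show ?case
      using g foldr_in_conjugate_products[OF ys(2)] derived_eq_lower_central[of G] by auto
  next
    case (Suc k)
    let ?D = "lower_central G (Suc (Suc (Suc k)))"
    interpret D: normal ?D G by (rule lower_central_normal)
    obtain d q where dq: "d \<in> lower_central G (Suc (Suc k))" "q \<in> conjugate_products G ys"
        "g \<otimes> ?p = d \<otimes> q"
      using Suc by blast
    have in_D: "commutator G b e \<in> ?D"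
      if "b \<in> lower_central G (Suc k)" "e \<in> lower_central G (Suc (Suc k))" for b e
      by (rule commutator_in_lower_central[OF subsetD[OF lower_central_in_carrier that(1)] that(2)])
    have "\<exists>d'\<in>?D. \<exists>q'\<in>conjugate_products G ys. d \<otimes> q = d' \<otimes> q'"
    proof (rule conjugate_products_step[where B = "lower_central G (Suc k)" and m = "Suc k"])
      show "d \<in> commutator_subgroup G (lower_central G (Suc k)) (carrier G)"
        using dq(1) by (simp only: lower_central_Suc)
    qed (use in_D ys dq(2) in \<open>auto simp: lower_central_normal simp flip: lower_central_Suc\<close>)
    then show ?case unfolding dq(3) .
  qed
  let ?A = "lower_central G (Suc c)"
  obtain d q where dq: "d \<in> lower_central G (Suc (Suc c))" "q \<in> conjugate_products G ys"
      "g \<otimes> ?p = d \<otimes> q"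
    using mod_lower by blast
  have triv: "commutator G a b = \<one>" if ab: "a \<in> ?A" "b \<in> ?A" for a b
  proof -
    have "a \<in> carrier G" "b \<in> carrier G" using ab subsetD[OF lower_central_in_carrier] by auto
    then show ?thesis using abelian[OF ab] by (simp add: word_simps)
  qed
  have "\<exists>d'\<in>{\<one>}. \<exists>q'\<in>conjugate_products G ys. d \<otimes> q = d' \<otimes> q'"
  proof (rule conjugate_products_step[OF lower_central_normal one_is_normal, where m = c])
    show "d \<in> commutator_subgroup G ?A (carrier G)"
      using dq(1) by (simp only: lower_central_Suc)
    fix b e assume b: "b \<in> ?A"
    { assume "e \<in> ?A" then show "commutator G b e \<in> {\<one>}" using triv b by simp }
    assume "e \<in> commutator_subgroup G ?A (carrier G)"
    then have "e \<in> ?A" using commutator_subgroup_subset[OF lower_central_normal] by blast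
    then show "commutator G b e \<in> {\<one>}" using triv b by simp
  qed (use ys dq(2) in auto)
  then obtain q' where "q' \<in> conjugate_products G ys" "d \<otimes> q = \<one> \<otimes> q'" by blast
  moreover have "q' \<in> carrier G" using calculation conjugate_products_in_carrier[OF ys(2)] by blast
  ultimately show ?thesis using dq(3) by simp
qed

section \<open>Groups generated by involutions\<close>

primrec sublist_products :: "('a, 'b) monoid_scheme \<Rightarrow> 'a list \<Rightarrow> 'a set" where
  "sublist_products G [] = {\<one>\<^bsub>G\<^esub>}"
| "sublist_products G (y # ys) =
     sublist_products G ys \<union> (\<lambda>r. y \<otimes>\<^bsub>G\<^esub> r) ` sublist_products G ys"

lemma sublist_products_foldr:
  "r \<in> sublist_products G ys \<Longrightarrow>
     \<exists>ws. set ws \<subseteq> set ys \<and> length ws \<le> length ys \<and> r = foldr (\<otimes>\<^bsub>G\<^esub>) ws \<one>\<^bsub>G\<^esub>"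
proof (induction ys arbitrary: r)
  case Nil then show ?case by (intro exI[of _ "[]"]) simp
next
  case (Cons y ys)
  then consider "r \<in> sublist_products G ys" | s where "s \<in> sublist_products G ys" "r = y \<otimes>\<^bsub>G\<^esub> s"
    by auto
  then show ?case
  proof cases
    case 1
    then obtain ws where "set ws \<subseteq> set ys" "length ws \<le> length ys" "r = foldr (\<otimes>\<^bsub>G\<^esub>) ws \<one>\<^bsub>G\<^esub>"
      using Cons.IH by blast
    then show ?thesis by (intro exI[of _ ws]) auto
  next
    case 2
    then obtain ws where "set ws \<subseteq> set ys" "length ws \<le> length ys" "s = foldr (\<otimes>\<^bsub>G\<^esub>) ws \<one>\<^bsub>G\<^esub>"
      using Cons.IH by blast
    then show ?thesis using 2(2) by (intro exI[of _ "y # ws"]) auto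
  qed
qed

lemma (in group) sublist_products_in_carrier:
  "set ys \<subseteq> carrier G \<Longrightarrow> sublist_products G ys \<subseteq> carrier G"
  by (induction ys) auto

lemma (in group) one_in_sublist_products: "\<one> \<in> sublist_products G ys"
  by (induction ys) auto

text \<open>Modulo the derived subgroup, multiplication by \<open>y\<close> either inserts the factor \<open>y\<close> into a subproduct or
cancels it; so the subproducts represent all of \<open>G / [G, G]\<close>.\<close>

lemma (in group) involution_mult_sublist_products:
  assumes "set ys \<subseteq> carrier G" "\<And>y. y \<in> set ys \<Longrightarrow> y \<otimes> y = \<one>"
    and "y \<in> set ys" "r \<in> sublist_products G ys"
  shows "\<exists>d\<in>derived G (carrier G). \<exists>r'\<in>sublist_products G ys. y \<otimes> r = d \<otimes> r'"
  using assms
proof (induction ys arbitrary: r)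
  case Nil then show ?case by simp
next
  case (Cons w ws)
  interpret D: normal "derived G (carrier G)" G by (rule derived_self_is_normal)
  note inC = sublist_products_in_carrier[of ws]
  have w: "w \<in> carrier G" and ws: "set ws \<subseteq> carrier G" and y: "y \<in> carrier G"
    using Cons.prems by auto
  consider (eq1) "y = w" "r \<in> sublist_products G ws"
    | (eq2) s where "y = w" "s \<in> sublist_products G ws" "r = w \<otimes> s"
    | (in1) "y \<in> set ws" "r \<in> sublist_products G ws"
    | (in2) s where "y \<in> set ws" "s \<in> sublist_products G ws" "r = w \<otimes> s"
    using Cons.prems(3,4) by auto
  then show ?case
  proof cases
    case eq1
    have "y \<otimes> r = \<one> \<otimes> (w \<otimes> r)" using eq1 subsetD[OF inC[OF ws]] w by simp
    moreover have "w \<otimes> r \<in> sublist_products G (w # ws)" using eq1 by simp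
    ultimately show ?thesis using D.one_closed by blast
  next
    case eq2
    have s: "s \<in> carrier G" using eq2 subsetD[OF inC[OF ws]] by simp
    have "w \<otimes> w = \<one>" using Cons.prems(2) by simp
    then have "y \<otimes> r = \<one> \<otimes> s" using eq2 s w by (simp add: m_assoc[symmetric])
    moreover have "s \<in> sublist_products G (w # ws)" using eq2 by simp
    ultimately show ?thesis using D.one_closed by blast
  next
    case in1
    then show ?thesis using Cons.IH[OF ws _ in1] Cons.prems(2) by auto
  next
    case in2
    obtain d s' where ds: "d \<in> derived G (carrier G)" "s' \<in> sublist_products G ws" "y \<otimes> s = d \<otimes> s'"
      using Cons.IH[OF ws _ in2(1,2)] Cons.prems(2) by auto
    have C: "s \<in> carrier G" "s' \<in> carrier G" "d \<in> carrier G"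
      using in2(2) ds(1,2) subsetD[OF inC[OF ws]] D.subset by auto
    let ?d = "commutator G y w \<otimes> (w \<otimes> d \<otimes> inv w)"
    have yw: "commutator G y w \<in> derived G (carrier G)"
      unfolding derived_def using y w by (intro generate.incl) blast
    have "?d \<in> derived G (carrier G)"
      by (rule D.m_closed[OF yw D.inv_op_closed2[OF w ds(1)]])
    moreover have "y \<otimes> r = ?d \<otimes> (w \<otimes> s')"
    proof -
      have "y \<otimes> r = commutator G y w \<otimes> w \<otimes> (y \<otimes> s)"
        unfolding in2(3) using w y C by (simp add: word_simps)
      then show ?thesis unfolding ds(3) using w y C by (simp add: word_simps)
    qed
    moreover have "w \<otimes> s' \<in> sublist_products G (w # ws)" using ds(2) by simp
    ultimately show ?thesis by blast
  qed
qed

lemma (in group) foldr_mult_closed: "set ws \<subseteq> carrier G \<Longrightarrow> foldr (\<otimes>) ws \<one> \<in> carrier G"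
  by (induction ws) auto

lemma (in group) foldr_mult_append:
  "set vs \<subseteq> carrier G \<Longrightarrow> set ws \<subseteq> carrier G \<Longrightarrow>
     foldr (\<otimes>) (vs @ ws) \<one> = foldr (\<otimes>) vs \<one> \<otimes> foldr (\<otimes>) ws \<one>"
  by (induction vs) (auto simp: m_assoc foldr_mult_closed)

lemma (in group) involution_inv: "y \<in> carrier G \<Longrightarrow> y \<otimes> y = \<one> \<Longrightarrow> inv y = y"
  by (rule inv_equality)

lemma (in group) generate_involutions_induct [consumes 3, case_names one mult]:
  assumes "g \<in> generate G Y" "Y \<subseteq> carrier G" "\<forall>y\<in>Y. y \<otimes> y = \<one>"
    and one: "P \<one>" and mult: "\<And>y h. y \<in> Y \<Longrightarrow> h \<in> carrier G \<Longrightarrow> P h \<Longrightarrow> P (y \<otimes> h)"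
  shows "P g"
proof -
  have "h \<in> carrier G \<Longrightarrow> P h \<Longrightarrow> P (g \<otimes> h)" for h
    using assms(1)
  proof (induction g arbitrary: h rule: generate.induct)
    case (eng a b)
    have "a \<in> carrier G" "b \<in> carrier G" 
      using eng.hyps generate_in_carrier[OF assms(2)] by auto
    then show ?case using eng by (simp add: m_assoc)
  next
    case (inv y)
    then have "inv y = y" using assms(2,3) by (intro involution_inv) auto
    then show ?case using inv mult by simp
  qed (use mult in auto)
  from this[of \<one>] show ?thesis
    using one generate_in_carrier[OF assms(2,1)] by simp
qed

lemma (in group) generate_involutions_sublist_products:
  assumes ys: "generate G (set ys) = carrier G" "set ys \<subseteq> carrier G"
    and inv: "\<And>y. y \<in> set ys \<Longrightarrow> y \<otimes> y = \<one>" and g: "g \<in> carrier G"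
  shows "\<exists>d\<in>derived G (carrier G). \<exists>r\<in>sublist_products G ys. g = d \<otimes> r"
proof -
  interpret D: normal "derived G (carrier G)" G by (rule derived_self_is_normal)
  have "g \<in> generate G (set ys)" "\<forall>y\<in>set ys. y \<otimes> y = \<one>" using ys(1) g inv by auto
  from this(1) ys(2) this(2) show ?thesis
  proof (induction rule: generate_involutions_induct)
    case one
    have "\<one> = \<one> \<otimes> \<one>" by simp
    then show ?case using one_in_sublist_products[of ys] D.one_closed by blast
  next
    case (mult y h)
    obtain d r where dr: "d \<in> derived G (carrier G)" "r \<in> sublist_products G ys" "h = d \<otimes> r"
      using mult.IH by blast
    obtain d' r' where dr': "d' \<in> derived G (carrier G)" "r' \<in> sublist_products G ys" "y \<otimes> r = d' \<otimes> r'"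
      using involution_mult_sublist_products[OF ys(2) inv mult.hyps(1) dr(2)] by blast
    have C: "y \<in> carrier G" "d \<in> carrier G" "r \<in> carrier G" "d' \<in> carrier G" "r' \<in> carrier G"
      using mult.hyps(1) ys(2) dr dr' subsetD[OF sublist_products_in_carrier[OF ys(2)]] D.subset by auto
    let ?d = "(y \<otimes> d \<otimes> inv y) \<otimes> d'"
    have "?d \<in> derived G (carrier G)"
      by (rule D.m_closed[OF D.inv_op_closed2[OF C(1) dr(1)] dr'(1)])
    moreover have "y \<otimes> h = ?d \<otimes> r'"
    proof -
      have "y \<otimes> h = (y \<otimes> d \<otimes> inv y) \<otimes> (y \<otimes> r)" unfolding dr(3) using C by (simp add: word_simps)
      then show ?thesis unfolding dr'(3) using C by (simp add: word_simps)
    qed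
    ultimately show ?case using dr'(2) by blast
  qed
qed

lemma (in group) conjugate_products_foldr:
  "q \<in> conjugate_products G ys \<Longrightarrow>
     \<exists>ps. set ps \<subseteq> {u \<otimes> y \<otimes> inv u | u y. u \<in> carrier G \<and> y \<in> set ys} \<and> length ps = length ys \<and>
       q = foldr (\<otimes>) ps \<one>"
proof (induction ys arbitrary: q)
  case (Cons y ys)
  obtain u q' where q: "u \<in> carrier G" "q' \<in> conjugate_products G ys" "q = (u \<otimes> y \<otimes> inv u) \<otimes> q'"
    using Cons.prems by auto
  obtain ps where ps: "set ps \<subseteq> {u \<otimes> y \<otimes> inv u | u y. u \<in> carrier G \<and> y \<in> set ys}"
      "length ps = length ys" "q' = foldr (\<otimes>) ps \<one>"
    using Cons.IH[OF q(2)] by blast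
  let ?C = "\<lambda>ys. {u \<otimes> y \<otimes> inv u | u y. u \<in> carrier G \<and> y \<in> set ys}"
  have "u \<otimes> y \<otimes> inv u \<in> ?C (y # ys)" using q(1) by auto
  moreover have "?C ys \<subseteq> ?C (y # ys)" by auto
  ultimately have "set ((u \<otimes> y \<otimes> inv u) # ps) \<subseteq> ?C (y # ys)" using ps(1) by simp
  moreover have "q = foldr (\<otimes>) ((u \<otimes> y \<otimes> inv u) # ps) \<one>" using q(3) ps(3) by simp
  moreover have "length ((u \<otimes> y \<otimes> inv u) # ps) = length (y # ys)" using ps(2) by simp
  ultimately show ?case by (intro exI conjI)
qed simp

text \<open>Write \<open>g = p d r\<close> with \<open>p = y\<^sub>1 \<cdots> y\<^sub>n\<close>, \<open>d \<in> [G, G]\<close> and \<open>r\<close> a subproduct of \<open>p\<close>. Then \<open>p d\<close> lies in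
the coset \<open>[G, G] p\<close> and is a product of \<open>n\<close> conjugates, and \<open>r\<close> is a product of at most \<open>n\<close>
generators.\<close>

theorem (in group) product_of_involution_conjugates:
  assumes ys: "generate G (set ys) = carrier G" "set ys \<subseteq> carrier G"
    and inv: "\<And>y. y \<in> set ys \<Longrightarrow> y \<otimes> y = \<one>"
    and abelian: "\<And>a b. a \<in> lower_central G (Suc c) \<Longrightarrow> b \<in> lower_central G (Suc c) \<Longrightarrow> a \<otimes> b = b \<otimes> a"
    and g: "g \<in> carrier G"
  shows "\<exists>ps. set ps \<subseteq> {u \<otimes> y \<otimes> inv u | u y. u \<in> carrier G \<and> y \<in> set ys} \<and>
           length ps \<le> 2 * length ys \<and> g = foldr (\<otimes>) ps \<one>"
proof -
  interpret D: normal "derived G (carrier G)" G by (rule derived_self_is_normal)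
  let ?C = "{u \<otimes> y \<otimes> inv u | u y. u \<in> carrier G \<and> y \<in> set ys}"
  let ?p = "foldr (\<otimes>) ys \<one>"
  have p: "?p \<in> carrier G" by (rule foldr_mult_closed[OF ys(2)])
  \<comment> \<open>The element \<open>p\<^sup>-\<^sup>1g\<close> is decomposed, so that \<open>p\<close> is available for the coset \<open>[G, G] p\<close>.\<close>
  obtain d r where dr: "d \<in> derived G (carrier G)" "r \<in> sublist_products G ys" "inv ?p \<otimes> g = d \<otimes> r"
    using generate_involutions_sublist_products[OF ys inv, of "inv ?p \<otimes> g"] p g by auto
  have C: "d \<in> carrier G" "r \<in> carrier G"
    using dr subsetD[OF sublist_products_in_carrier[OF ys(2)]] D.subset by auto
  obtain ws where ws: "set ws \<subseteq> set ys" "length ws \<le> length ys" "r = foldr (\<otimes>) ws \<one>"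
    using sublist_products_foldr[OF dr(2)] by blast
  have "(?p \<otimes> d \<otimes> inv ?p) \<otimes> ?p \<in> conjugate_products G ys"
    by (rule derived_coset_conjugate_products[OF ys abelian D.inv_op_closed2[OF p dr(1)]])
  then obtain ps where ps: "set ps \<subseteq> ?C" "length ps = length ys"
      "(?p \<otimes> d \<otimes> inv ?p) \<otimes> ?p = foldr (\<otimes>) ps \<one>"
    using conjugate_products_foldr by blast
  have wsC: "set ws \<subseteq> ?C"
  proof
    fix w assume "w \<in> set ws"
    then have "w \<in> set ys" "w \<in> carrier G" using ws(1) ys(2) by auto
    then have "w = \<one> \<otimes> w \<otimes> inv \<one>" by simp
    then show "w \<in> ?C" using \<open>w \<in> set ys\<close> by (intro CollectI exI conjI) (assumption | rule one_closed)+
  qed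
  have CC: "?C \<subseteq> carrier G" using ys(2) by auto
  have "g = ?p \<otimes> (inv ?p \<otimes> g)" using p g by (simp add: word_simps)
  also have "\<dots> = ((?p \<otimes> d \<otimes> inv ?p) \<otimes> ?p) \<otimes> r" unfolding dr(3) using p C by (simp add: word_simps)
  also have "\<dots> = foldr (\<otimes>) (ps @ ws) \<one>"
    unfolding ps(3) ws(3) using ps(1) wsC CC by (intro foldr_mult_append[symmetric]) auto
  finally show ?thesis using ps(1,2) ws(2) wsC by (intro exI[of _ "ps @ ws"]) simp
qed

section \<open>The universal property of a free basis\<close>

definition letter_value :: "('a, 'b) monoid_scheme \<Rightarrow> ('i \<Rightarrow> 'a) \<Rightarrow> 'i \<times> bool \<Rightarrow> 'a" where
  "letter_value G x l = (if snd l then x (fst l) else inv\<^bsub>G\<^esub> (x (fst l)))"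

lemma word_value_Nil [simp]: "word_value G x [] = \<one>\<^bsub>G\<^esub>"
  by (simp add: word_value_def)

lemma word_value_Cons [simp]: "word_value G x (l # w) = letter_value G x l \<otimes>\<^bsub>G\<^esub> word_value G x w"
  by (cases l) (simp add: word_value_def letter_value_def)

lemma (in group) letter_value_closed:
  "x ` I \<subseteq> carrier G \<Longrightarrow> fst l \<in> I \<Longrightarrow> letter_value G x l \<in> carrier G"
  by (auto simp: letter_value_def)

lemma (in group) word_value_closed:
  "x ` I \<subseteq> carrier G \<Longrightarrow> fst ` set w \<subseteq> I \<Longrightarrow> word_value G x w \<in> carrier G"
  by (induction w) (auto intro!: m_closed letter_value_closed[of x I])

lemma (in group) word_value_append:
  assumes "x ` I \<subseteq> carrier G" "fst ` set v \<subseteq> I" "fst ` set w \<subseteq> I"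
  shows "word_value G x (v @ w) = word_value G x v \<otimes> word_value G x w"
  using assms(2)
proof (induction v)
  case Nil then show ?case using word_value_closed[OF assms(1,3)] by simp
next
  case (Cons l v)
  then have "letter_value G x l \<in> carrier G" "word_value G x v \<in> carrier G"
    using letter_value_closed[OF assms(1)] word_value_closed[OF assms(1), of v] by auto
  then show ?case using Cons word_value_closed[OF assms(1,3)] by (simp add: m_assoc)
qed

lemma (in group) word_value_letter_act:
  assumes "x ` I \<subseteq> carrier G" "fst l \<in> I" "fst ` set w \<subseteq> I"
  shows "word_value G x (letter_act l w) = letter_value G x l \<otimes> word_value G x w"
proof (cases "\<exists>v. w = (fst l, \<not> snd l) # v")
  case True
  then obtain v where v: "w = (fst l, \<not> snd l) # v" by blast
  have "word_value G x v \<in> carrier G" using word_value_closed[OF assms(1), of v] assms(3) v by simp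
  moreover have "x (fst l) \<in> carrier G" using assms(1,2) by blast
  ultimately show ?thesis
    unfolding v by (auto simp: letter_act_def letter_value_def word_simps)
next
  case False
  then have "letter_act l w = l # w" by (cases w) (auto simp: letter_act_def prod_eq_iff)
  then show ?thesis by simp
qed

lemma foldr_letter_act_reduced:
  "fst ` set w \<subseteq> I \<Longrightarrow> foldr letter_act w [] \<in> reduced_words I"
proof (induction w)
  case Nil then show ?case by (simp add: reduced_words_def)
next
  case (Cons l w) then show ?case using letter_act_red[of l I "foldr letter_act w []"] by simp
qed

lemma reduced_words_letters: "w \<in> reduced_words I \<Longrightarrow> fst ` set w \<subseteq> I"
  by (simp add: reduced_words_def)

text \<open>The word \<open>foldr letter_act w []\<close> is the free reduction of \<open>w\<close>, and reduction preserves the value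
in every group.\<close>

lemma (in group) word_value_foldr_letter_act:
  assumes "x ` I \<subseteq> carrier G" "fst ` set w \<subseteq> I"
  shows "word_value G x (foldr letter_act w []) = word_value G x w"
  using assms(2)
proof (induction w)
  case (Cons l w)
  then show ?case
    using word_value_letter_act[OF assms(1), of l "foldr letter_act w []"]
      reduced_words_letters[OF foldr_letter_act_reduced, of w I] by simp
qed simp

text \<open>An element is sent to the value in \<open>H\<close> of its reduced word. This is multiplicative because two
words with the same value in \<open>F\<close> have the same free reduction, hence the same value in \<open>H\<close>.\<close>

theorem free_basis_universal:
  assumes F: "free_basis F I x" and H: "group H" and h: "h ` I \<subseteq> carrier H"
  shows "\<exists>\<phi>\<in>hom F H. \<forall>i\<in>I. \<phi> (x i) = h i"
proof -
  interpret F: group F using F by (simp add: free_basis_def)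
  interpret H: group H by fact
  have xF: "x ` I \<subseteq> carrier F" and bij: "bij_betw (word_value F x) (reduced_words I) (carrier F)"
    using F by (auto simp: free_basis_def)
  define r where "r = inv_into (reduced_words I) (word_value F x)"
  have r: "r g \<in> reduced_words I" "word_value F x (r g) = g" if "g \<in> carrier F" for g
    using that bij unfolding r_def by (auto simp: bij_betw_def intro: inv_into_into f_inv_into_f)
  have rI: "r (word_value F x w) = w" if "w \<in> reduced_words I" for w
    unfolding r_def by (rule inv_into_f_f) (use that bij in \<open>auto simp: bij_betw_def\<close>)
  define \<phi> where "\<phi> g = word_value H h (r g)" for g
  have val: "\<phi> (word_value F x w) = word_value H h w" if w: "fst ` set w \<subseteq> I" for w
    using rI[OF foldr_letter_act_reduced[OF w]] F.word_value_foldr_letter_act[OF xF w]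
      H.word_value_foldr_letter_act[OF h w] by (simp add: \<phi>_def)
  have "\<phi> \<in> hom F H"
  proof (rule homI)
    fix g assume "g \<in> carrier F"
    then show "\<phi> g \<in> carrier H"
      unfolding \<phi>_def by (intro H.word_value_closed[OF h] reduced_words_letters r)
  next
    fix g g' assume g: "g \<in> carrier F" "g' \<in> carrier F"
    note let_r = reduced_words_letters[OF r(1)[OF g(1)]] reduced_words_letters[OF r(1)[OF g(2)]]
    have "g \<otimes>\<^bsub>F\<^esub> g' = word_value F x (r g @ r g')"
      using F.word_value_append[OF xF let_r] r g by simp
    then have "\<phi> (g \<otimes>\<^bsub>F\<^esub> g') = word_value H h (r g @ r g')"
      using val[of "r g @ r g'"] let_r by (simp add: image_Un)
    then show "\<phi> (g \<otimes>\<^bsub>F\<^esub> g') = \<phi> g \<otimes>\<^bsub>H\<^esub> \<phi> g'"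
      using H.word_value_append[OF h let_r] by (simp add: \<phi>_def)
  qed
  moreover have "\<phi> (x i) = h i" if "i \<in> I" for i
  proof -
    have "x i \<in> carrier F" "h i \<in> carrier H" using that xF h by auto
    then show ?thesis using val[of "[(i, True)]"] that by (simp add: letter_value_def)
  qed
  ultimately show ?thesis by blast
qed

lemma free_basis_generates:
  assumes "free_basis F I x"
  shows "generate F (x ` I) = carrier F"
proof -
  interpret F: group F using assms by (simp add: free_basis_def)
  have xF: "x ` I \<subseteq> carrier F" and bij: "bij_betw (word_value F x) (reduced_words I) (carrier F)"
    using assms by (auto simp: free_basis_def)
  have "word_value F x w \<in> generate F (x ` I)" if "fst ` set w \<subseteq> I" for w
    using that
  proof (induction w)
    case (Cons l w)
    have "fst l \<in> I" using Cons.prems by simp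
    then have "letter_value F x l \<in> generate F (x ` I)"
      by (simp add: letter_value_def generate.incl generate.inv)
    moreover have "word_value F x w \<in> generate F (x ` I)" using Cons by simp
    ultimately show ?case unfolding word_value_Cons by (rule generate.eng)
  qed (simp add: generate.one)
  then have "word_value F x ` reduced_words I \<subseteq> generate F (x ` I)"
    using reduced_words_letters by blast
  then have "carrier F \<subseteq> generate F (x ` I)"
    using bij_betw_imp_surj_on[OF bij] by simp
  then show ?thesis using F.generate_incl[OF xF] by blast
qed

section \<open>Palindromes and the palindromic width\<close>

lemma palindrome_Cons_snoc:
  assumes "rev (l # v @ [m]) = l # v @ [m]"
  shows "m = l \<and> rev v = v"
proof -
  have "m # (rev v @ [l]) = l # (v @ [m])"
    using assms by (simp only: rev.simps rev_append append.simps)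
  then have "m = l" "rev v @ [l] = v @ [m]"
    by (simp_all only: list.inject)
  then show ?thesis
    by (simp only: append1_eq_conv)
qed

text \<open>Stripping equal outer letters \<open>y\<close> from a palindrome undoes a conjugation by \<open>y = y\<^sup>-\<^sup>1\<close>; what remains
in the middle is a letter or nothing.\<close>

lemma (in group) word_value_palindrome:
  assumes Y: "Y \<subseteq> carrier G" "\<And>y. y \<in> Y \<Longrightarrow> y \<otimes> y = \<one>"
    and w: "fst ` set w \<subseteq> Y" "rev w = w"
  shows "word_value G (\<lambda>s. s) w = \<one> \<or>
    (\<exists>u\<in>carrier G. \<exists>y\<in>Y. word_value G (\<lambda>s. s) w = u \<otimes> y \<otimes> inv u)"
  using w
proof (induction "length w" arbitrary: w rule: less_induct)
  case less
  have Yimg: "(\<lambda>s. s) ` Y \<subseteq> carrier G" using Y(1) by simp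
  have let_v: "letter_value G (\<lambda>s. s) l = fst l" if "fst l \<in> Y" for l
    using that Y by (auto simp: letter_value_def involution_inv)
  consider "w = []" | l where "w = [l]" | l m v where "w = l # v @ [m]"
    by (metis append_butlast_last_id list.exhaust)
  then show ?case
  proof cases
    case 1 then show ?thesis by simp
  next
    case 2
    then have l: "fst l \<in> Y" "fst l \<in> carrier G" using less.prems Y(1) by auto
    have "word_value G (\<lambda>s. s) w = fst l" using 2 let_v[OF l(1)] l(2) by simp
    also have "\<dots> = \<one> \<otimes> fst l \<otimes> inv \<one>" using l(2) by simp
    finally have eq: "word_value G (\<lambda>s. s) w = \<one> \<otimes> fst l \<otimes> inv \<one>" .
    show ?thesis
      by (rule disjI2, rule bexI[of _ \<one>], rule bexI[of _ "fst l"], rule eq, rule l(1), rule one_closed)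
  next
    case 3
    have "rev (l # v @ [m]) = l # v @ [m]"
      by (rule less.prems(2)[unfolded 3])
    then have "m = l \<and> rev v = v"
      by (rule palindrome_Cons_snoc)
    then have lm: "m = l" "rev v = v"
      by blast+
    have l: "fst l \<in> Y" and v: "fst ` set v \<subseteq> Y" using less.prems(1) unfolding 3 by auto
    let ?y = "fst l"
    have y: "?y \<in> carrier G" "inv ?y = ?y" using l Y by (auto intro: involution_inv)
    have vC: "word_value G (\<lambda>s. s) v \<in> carrier G" by (rule word_value_closed[OF Yimg v])
    have "word_value G (\<lambda>s. s) (v @ [m]) = word_value G (\<lambda>s. s) v \<otimes> ?y"
      using word_value_append[OF Yimg v, of "[m]"] l lm(1) let_v y by simp
    then have eq: "word_value G (\<lambda>s. s) w = ?y \<otimes> word_value G (\<lambda>s. s) v \<otimes> inv ?y"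
      using 3 l let_v y vC by (simp add: m_assoc)
    consider "word_value G (\<lambda>s. s) v = \<one>"
      | u z where "u \<in> carrier G" "z \<in> Y" "word_value G (\<lambda>s. s) v = u \<otimes> z \<otimes> inv u"
      using less.hyps[of v] 3 v lm(2) by auto
    then show ?thesis
    proof cases
      case 1
      then show ?thesis using eq y Y(2)[OF l] by simp
    next
      case (2 u z)
      have "z \<in> carrier G" using 2 Y(1) by blast
      then have eq': "word_value G (\<lambda>s. s) w = (?y \<otimes> u) \<otimes> z \<otimes> inv (?y \<otimes> u)"
        unfolding eq 2(3) using y(1) 2(1) by (simp add: word_simps)
      show ?thesis
        by (rule disjI2, rule bexI[of _ "?y \<otimes> u"], rule bexI[of _ z], rule eq', rule 2(2),
            rule m_closed[OF y(1) 2(1)])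
    qed
  qed
qed

text \<open>A word in the \<open>y\<close> alone, without their formal inverses, is reduced. Therefore \<open>u y u\<^sup>-\<^sup>1\<close>, with \<open>u\<close>
written as such a word, is the value of a reduced palindrome even where equal letters meet.\<close>

lemma (in group) conjugates_are_palindromes:
  assumes Y: "generate G Y = carrier G" "Y \<subseteq> carrier G" "\<And>y. y \<in> Y \<Longrightarrow> y \<otimes> y = \<one>"
    and u: "u \<in> carrier G" and y: "y \<in> Y"
  shows "u \<otimes> y \<otimes> inv u \<in> palindromes G Y"
proof -
  have Yimg: "(\<lambda>s. s) ` Y \<subseteq> carrier G" using Y(2) by simp
  let ?pos = "map (\<lambda>s. (s, True))"
  have "u \<in> generate G Y" "\<forall>y\<in>Y. y \<otimes> y = \<one>" using u Y(1,3) by auto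
  from this(1) Y(2) this(2)
  have "\<exists>us. set us \<subseteq> Y \<and> rev us = us \<and> word_value G (\<lambda>s. s) (?pos us) = u \<otimes> y \<otimes> inv u"
  proof (induction rule: generate_involutions_induct)
    case one
    then show ?case using y Y(2) by (intro exI[of _ "[y]"]) (auto simp: letter_value_def)
  next
    case (mult z h)
    obtain us where us: "set us \<subseteq> Y" "rev us = us"
        "word_value G (\<lambda>s. s) (?pos us) = h \<otimes> y \<otimes> inv h"
      using mult.IH by blast
    have C: "z \<in> carrier G" "y \<in> carrier G" and z: "inv z = z"
      using mult.hyps(1) y Y by (auto intro: involution_inv)
    have "word_value G (\<lambda>s. s) (?pos us @ [(z, True)]) = (h \<otimes> y \<otimes> inv h) \<otimes> z"
      using word_value_append[OF Yimg, of "?pos us" "[(z, True)]"] us mult.hyps(1) C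
      by (simp add: letter_value_def image_image)
    then have "word_value G (\<lambda>s. s) (?pos (z # us @ [z])) = z \<otimes> ((h \<otimes> y \<otimes> inv h) \<otimes> z)"
      by (simp add: letter_value_def)
    also have "\<dots> = (z \<otimes> h) \<otimes> y \<otimes> inv (z \<otimes> h)"
      using C mult.hyps(2) z by (simp add: word_simps)
    finally show ?case using us mult.hyps(1) by (intro exI[of _ "z # us @ [z]"]) simp
  qed
  then obtain us where us: "set us \<subseteq> Y" "rev us = us"
      "word_value G (\<lambda>s. s) (?pos us) = u \<otimes> y \<otimes> inv u"
    by blast
  have "successively (\<lambda>(i, a) (j, b). \<not> (i = j \<and> a \<noteq> b)) (?pos us)"
    by (induction us) (auto simp: successively_Cons hd_map)
  then have "?pos us \<in> reduced_words Y" using us(1) by (auto simp: reduced_words_def)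
  moreover have "rev (?pos us) = ?pos us" using us(2) by (simp add: rev_map)
  ultimately show ?thesis
    unfolding palindromes_def
    by (intro CollectI exI[of _ "?pos us"] conjI us(3)[symmetric])
qed

lemma palindromic_width_le:
  assumes "\<And>g. g \<in> carrier G \<Longrightarrow>
    \<exists>ps. set ps \<subseteq> palindromes G Y \<and> length ps \<le> k \<and> g = foldr (\<otimes>\<^bsub>G\<^esub>) ps \<one>\<^bsub>G\<^esub>"
  shows "palindromic_width G Y \<le> enat k"
  unfolding palindromic_width_def
proof (rule SUP_least)
  fix g assume "g \<in> carrier G"
  then obtain ps where ps: "set ps \<subseteq> palindromes G Y" "length ps \<le> k" "g = foldr (\<otimes>\<^bsub>G\<^esub>) ps \<one>\<^bsub>G\<^esub>"
    using assms by blast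
  have "palindromic_length G Y g \<le> enat (length ps)"
    unfolding palindromic_length_def by (rule Inf_lower) (use ps in blast)
  also have "\<dots> \<le> enat k" using ps(2) by simp
  finally show "palindromic_length G Y g \<le> enat k" .
qed

lemma le_palindromic_width:
  assumes "g \<in> carrier G"
    and "\<And>ps. set ps \<subseteq> palindromes G Y \<Longrightarrow> foldr (\<otimes>\<^bsub>G\<^esub>) ps \<one>\<^bsub>G\<^esub> = g \<Longrightarrow> k \<le> length ps"
  shows "enat k \<le> palindromic_width G Y"
  unfolding palindromic_width_def
proof (rule SUP_upper2[OF assms(1)])
  show "enat k \<le> palindromic_length G Y g"
    unfolding palindromic_length_def by (rule Inf_greatest) (use assms(2) in auto)
qed

text \<open>The elementary abelian 2-group on \<open>'i\<close>, a vector over \<open>\<int>/2\<close> being given by its support; addition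
becomes symmetric difference.\<close>

definition parity_group :: "'i set monoid" where
  "parity_group = \<lparr>carrier = UNIV, mult = (\<lambda>A B. (A - B) \<union> (B - A)), one = {}\<rparr>"

lemma parity_group_simps [simp]:
  "carrier parity_group = UNIV" "A \<otimes>\<^bsub>parity_group\<^esub> B = (A - B) \<union> (B - A)" "\<one>\<^bsub>parity_group\<^esub> = {}"
  by (simp_all add: parity_group_def)

lemma comm_group_parity_group: "comm_group parity_group"
proof (rule comm_groupI)
  fix A :: "'i set"
  show "\<exists>B\<in>carrier parity_group. B \<otimes>\<^bsub>parity_group\<^esub> A = \<one>\<^bsub>parity_group\<^esub>"
    by (intro bexI[of _ A]) auto
qed auto

lemma inv_parity_group [simp]: "inv\<^bsub>parity_group\<^esub> A = A"
proof -
  interpret comm_group "parity_group :: 'a set monoid" by (rule comm_group_parity_group)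
  show ?thesis by (rule inv_equality) auto
qed

text \<open>A palindrome has a support of at most one element, so a product of \<open>k\<close> palindromes has one of at
most \<open>k\<close> elements, whereas the product of all generators has support \<open>I\<close>.\<close>

lemma (in group) palindromic_width_ge_parity:
  assumes \<psi>: "\<psi> \<in> hom G parity_group"
    and y: "y ` I \<subseteq> carrier G" "\<And>i. i \<in> I \<Longrightarrow> y i \<otimes> y i = \<one>" "\<And>i. i \<in> I \<Longrightarrow> \<psi> (y i) = {i}"
    and I: "finite I"
  shows "enat (card I) \<le> palindromic_width G (y ` I)"
proof -
  interpret V: comm_group "parity_group :: 'c set monoid" by (rule comm_group_parity_group)
  interpret \<psi>: group_hom G parity_group \<psi> using \<psi> by unfold_locales
  have pal: "p \<in> carrier G \<and> finite (\<psi> p) \<and> card (\<psi> p) \<le> 1" if p_pal: "p \<in> palindromes G (y ` I)" for p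
  proof -
    obtain w where w: "p = word_value G (\<lambda>s. s) w" "w \<in> reduced_words (y ` I)" "rev w = w"
      using p_pal by (auto simp: palindromes_def)
    have "p = \<one> \<or> (\<exists>u\<in>carrier G. \<exists>z\<in>y ` I. p = u \<otimes> z \<otimes> inv u)"
      unfolding w(1)
      by (rule word_value_palindrome[OF y(1) _ reduced_words_letters[OF w(2)] w(3)]) (use y(2) in auto)
    then show ?thesis
    proof (elim disjE bexE)
      fix u z assume u: "u \<in> carrier G" and "z \<in> y ` I" and p: "p = u \<otimes> z \<otimes> inv u"
      then obtain i where i: "i \<in> I" "z = y i" by blast
      have z: "z \<in> carrier G" using i y(1) by blast
      have "\<psi> p = (\<psi> u \<otimes>\<^bsub>parity_group\<^esub> \<psi> z) \<otimes>\<^bsub>parity_group\<^esub> \<psi> u"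
        using u z by (simp add: p del: parity_group_simps(2))
      also have "\<dots> = {i}" using y(3)[OF i(1)] i(2) by auto
      finally show ?thesis using u z p by simp
    qed simp
  qed
  have card_le: "foldr (\<otimes>) ps \<one> \<in> carrier G \<and>
      finite (\<psi> (foldr (\<otimes>) ps \<one>)) \<and> card (\<psi> (foldr (\<otimes>) ps \<one>)) \<le> length ps"
    if "set ps \<subseteq> palindromes G (y ` I)" for ps
    using that
  proof (induction ps)
    case (Cons p ps)
    let ?g = "foldr (\<otimes>) ps \<one>"
    have p: "p \<in> carrier G" "finite (\<psi> p)" "card (\<psi> p) \<le> 1" using pal Cons.prems by auto
    have g: "?g \<in> carrier G" "finite (\<psi> ?g)" "card (\<psi> ?g) \<le> length ps" using Cons by auto
    have eq: "\<psi> (p \<otimes> ?g) = (\<psi> p - \<psi> ?g) \<union> (\<psi> ?g - \<psi> p)" using p(1) g(1) by simp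
    have "card (\<psi> (p \<otimes> ?g)) \<le> card (\<psi> p \<union> \<psi> ?g)"
      unfolding eq by (rule card_mono) (use p g in auto)
    also have "\<dots> \<le> card (\<psi> p) + card (\<psi> ?g)" by (rule card_Un_le)
    finally have "card (\<psi> (p \<otimes> ?g)) \<le> length (p # ps)" using p g by simp
    moreover have "finite (\<psi> (p \<otimes> ?g))" unfolding eq using p g by simp
    ultimately show ?case using p(1) g(1) by simp
  qed simp
  obtain idx where idx: "set idx = I" "distinct idx" using finite_distinct_list[OF I] by blast
  have prod: "foldr (\<otimes>) (map y js) \<one> \<in> carrier G \<and> \<psi> (foldr (\<otimes>) (map y js) \<one>) = set js"
    if "set js \<subseteq> I" "distinct js" for js
    using that
  proof (induction js)
    case (Cons j js)
    have "y j \<in> carrier G" using Cons.prems y(1) by auto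
    then show ?case using Cons y(3)[of j] by auto
  qed simp
  show ?thesis
  proof (rule le_palindromic_width)
    show "foldr (\<otimes>) (map y idx) \<one> \<in> carrier G" using prod idx by simp
    fix ps assume "set ps \<subseteq> palindromes G (y ` I)" "foldr (\<otimes>) ps \<one> = foldr (\<otimes>) (map y idx) \<one>"
    then show "card I \<le> length ps" using card_le[of ps] prod[of idx] idx by simp
  qed
qed

section \<open>The quotients of free groups\<close>

lemma (in group) normal_closure_normal:
  assumes S: "S \<subseteq> carrier G"
  shows "normal_closure G S \<lhd> G"
  unfolding normal_closure_def
proof (rule normal_generateI)
  fix h g assume "h \<in> {g \<otimes> s \<otimes> inv g | g s. g \<in> carrier G \<and> s \<in> S}" and g: "g \<in> carrier G"
  then obtain k s where ks: "k \<in> carrier G" "s \<in> S" "h = k \<otimes> s \<otimes> inv k" by blast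
  have s: "s \<in> carrier G" using ks(2) S by blast
  have "g \<otimes> h \<otimes> inv g = (g \<otimes> k) \<otimes> s \<otimes> inv (g \<otimes> k)"
    unfolding ks(3) using g ks(1) s by (simp add: word_simps)
  then show "g \<otimes> h \<otimes> inv g \<in> {g \<otimes> s \<otimes> inv g | g s. g \<in> carrier G \<and> s \<in> S}"
    using ks(2) m_closed[OF g ks(1)] by (intro CollectI exI conjI)
qed (use S in auto)

lemma (in group) normal_closure_incl:
  assumes S: "S \<subseteq> carrier G" and s: "s \<in> S"
  shows "s \<in> normal_closure G S"
proof -
  have "s = \<one> \<otimes> s \<otimes> inv \<one>" using subsetD[OF S s] by simp
  then have "s \<in> {g \<otimes> s \<otimes> inv g | g s. g \<in> carrier G \<and> s \<in> S}"
    using s one_closed by (intro CollectI exI conjI)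
  then show ?thesis unfolding normal_closure_def by (rule generate.incl)
qed

lemma (in group_hom) normal_closure_in_kernel:
  assumes S: "S \<subseteq> kernel G H h"
  shows "normal_closure G S \<subseteq> kernel G H h"
  unfolding normal_closure_def
proof (rule G.generate_subgroup_incl[OF _ subgroup_kernel], clarify)
  fix g s assume "g \<in> carrier G" "s \<in> S"
  then show "g \<otimes> s \<otimes> inv g \<in> kernel G H h"
    by (intro normal.inv_op_closed2[OF normal_kernel]) (use S in auto)
qed

lemma (in group_hom) derived_in_kernel:
  assumes "comm_group H" "A \<subseteq> carrier G"
  shows "derived G A \<subseteq> kernel G H h"
proof -
  have "h ` derived G A = derived H (h ` A)"
    by (rule derived_img[OF assms(2), symmetric])
  also have "\<dots> = {\<one>\<^bsub>H\<^esub>}"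
    by (rule comm_group.derived_eq_singleton[OF assms(1)]) (use assms(2) in auto)
  finally show ?thesis
    using G.derived_in_carrier[OF assms(2)] unfolding kernel_def by blast
qed

text \<open>Composing the two quotient maps gives a homomorphism \<open>\<phi>\<close> from \<open>F\<close> onto \<open>G\<close>. It carries the
lower central series of \<open>F\<close> to that of \<open>G\<close>, so \<open>\<gamma>\<^sub>c\<^sub>+\<^sub>1(G)\<close> is abelian, the commutators of
\<open>\<gamma>\<^sub>c\<^sub>+\<^sub>1(F)\<close> being killed; and it carries the basis to involutions generating \<open>G\<close>. The parity map
factors through \<open>\<phi>\<close>, which gives the lower bound.\<close>

theorem palindromic_width_involution_quotient:
  fixes F :: "('a, 'b) monoid_scheme" and n c :: nat and x :: "nat \<Rightarrow> 'a"
  assumes F: "free_basis F {1..n} x"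
  defines "AN \<equiv> F Mod ab_nilp_kernel F c"
  defines "X \<equiv> coset_image F (ab_nilp_kernel F c) (x ` {1..n})"
  defines "G \<equiv> AN Mod squares_closure AN X"
  defines "Y \<equiv> coset_image AN (squares_closure AN X) X"
  shows "enat n \<le> palindromic_width G Y" and "palindromic_width G Y \<le> enat (2 * n)"
proof -
  define K where "K = ab_nilp_kernel F c"
  define S where "S = squares_closure AN X"
  interpret F: group F using F by (simp add: free_basis_def)
  have xF: "x ` {1..n} \<subseteq> carrier F" using F by (simp add: free_basis_def)
  have K_derived: "K = derived F (lower_central F (Suc c))"
    by (simp add: K_def ab_nilp_kernel_def)
  interpret K: normal K F
    unfolding K_derived by (rule F.derived_is_normal[OF F.lower_central_normal])
  have AN: "AN = F Mod K" by (simp add: AN_def K_def)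
  interpret AN: group AN unfolding AN by (rule K.factorgroup_is_group)
  let ?\<kappa> = "\<lambda>g. K #>\<^bsub>F\<^esub> g"
  interpret \<kappa>: group_hom F AN ?\<kappa>
    by unfold_locales (use K.r_coset_hom_Mod in \<open>simp add: AN\<close>)
  have X: "X = ?\<kappa> ` x ` {1..n}" by (simp add: X_def coset_image_def K_def)
  have XC: "X \<subseteq> carrier AN" unfolding X using xF \<kappa>.hom_closed by blast
  let ?sq = "(\<lambda>a. a [^]\<^bsub>AN\<^esub> (2::nat)) ` X"
  have sqC: "?sq \<subseteq> carrier AN" using XC by auto
  have S: "S = normal_closure AN ?sq" by (simp add: S_def squares_closure_def)
  interpret S: normal S AN
    unfolding S by (rule AN.normal_closure_normal[OF sqC])
  have G: "G = AN Mod S" by (simp add: G_def S_def)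
  interpret G: group G unfolding G by (rule S.factorgroup_is_group)
  let ?\<sigma> = "\<lambda>a. S #>\<^bsub>AN\<^esub> a"
  interpret \<sigma>: group_hom AN G ?\<sigma>
    by unfold_locales (use S.r_coset_hom_Mod in \<open>simp add: G\<close>)
  define \<phi> where "\<phi> g = ?\<sigma> (?\<kappa> g)" for g
  interpret \<phi>: group_hom F G \<phi>
  proof (unfold_locales, rule homI)
    show "\<phi> g \<in> carrier G" if "g \<in> carrier F" for g
      unfolding \<phi>_def by (intro \<sigma>.hom_closed \<kappa>.hom_closed that)
    show "\<phi> (g \<otimes>\<^bsub>F\<^esub> h) = \<phi> g \<otimes>\<^bsub>G\<^esub> \<phi> h" if "g \<in> carrier F" "h \<in> carrier F" for g h
      unfolding \<phi>_def
      by (simp only: \<kappa>.hom_mult[OF that] \<sigma>.hom_mult \<kappa>.hom_closed that)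
  qed
  have \<kappa>_surj: "?\<kappa> ` carrier F = carrier AN" by (simp add: AN carrier_FactGroup)
  have \<phi>_surj: "\<phi> ` carrier F = carrier G"
  proof -
    have "\<phi> ` carrier F = ?\<sigma> ` ?\<kappa> ` carrier F" by (simp add: \<phi>_def image_image)
    also have "\<dots> = carrier G" unfolding \<kappa>_surj by (simp add: G carrier_FactGroup)
    finally show ?thesis .
  qed
  define y where "y i = \<phi> (x i)" for i
  have "Y = ?\<sigma> ` X" by (simp only: Y_def S_def coset_image_def)
  then have Y: "Y = y ` {1..n}" by (simp add: X image_image y_def \<phi>_def)
  have yC: "y ` {1..n} \<subseteq> carrier G" using xF \<phi>.hom_closed unfolding y_def by blast
  have gen: "generate G (y ` {1..n}) = carrier G"
  proof -
    have "y ` {1..n} = \<phi> ` x ` {1..n}" by (simp add: y_def image_image)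
    then show ?thesis
      using \<phi>.generate_img[OF xF] free_basis_generates[OF F] \<phi>_surj by simp
  qed
  have inv: "z \<otimes>\<^bsub>G\<^esub> z = \<one>\<^bsub>G\<^esub>" if z: "z \<in> y ` {1..n}" for z
  proof -
    obtain a where a: "a \<in> X" "z = ?\<sigma> a"
      using z unfolding X y_def \<phi>_def by blast
    have aC: "a \<in> carrier AN" using a(1) XC by blast
    have "a [^]\<^bsub>AN\<^esub> (2::nat) \<in> S"
      unfolding S by (rule AN.normal_closure_incl[OF sqC]) (use a(1) in blast)
    moreover have "a [^]\<^bsub>AN\<^esub> (2::nat) = a \<otimes>\<^bsub>AN\<^esub> a"
      using aC by (simp add: numeral_2_eq_2)
    ultimately have "a \<otimes>\<^bsub>AN\<^esub> a \<in> S" by simp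
    then have "?\<sigma> (a \<otimes>\<^bsub>AN\<^esub> a) = S" by (rule S.rcos_const[OF AN.is_group])
    then show ?thesis using \<sigma>.hom_mult[OF aC aC] a(2) by (simp add: G)
  qed
  have abelian: "a \<otimes>\<^bsub>G\<^esub> b = b \<otimes>\<^bsub>G\<^esub> a"
    if ab: "a \<in> lower_central G (Suc c)" "b \<in> lower_central G (Suc c)" for a b
  proof -
    obtain a' b' where ab': "a' \<in> lower_central F (Suc c)" "b' \<in> lower_central F (Suc c)"
        "a = \<phi> a'" "b = \<phi> b'"
      using ab unfolding \<phi>.lower_central_img[OF \<phi>_surj] by blast
    have C: "a' \<in> carrier F" "b' \<in> carrier F"
      using ab' subsetD[OF F.lower_central_in_carrier] by auto
    have aG: "a \<in> carrier G" "b \<in> carrier G" using ab' C \<phi>.hom_closed by auto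
    have "commutator F a' b' \<in> K"
      unfolding K_derived derived_def by (rule generate.incl) (use ab' in blast)
    then have "?\<kappa> (commutator F a' b') = K" by (rule K.rcos_const[OF F.is_group])
    then have "?\<kappa> (commutator F a' b') = \<one>\<^bsub>AN\<^esub>" by (simp add: AN)
    then have "\<phi> (commutator F a' b') = \<one>\<^bsub>G\<^esub>" unfolding \<phi>_def by simp
    then have "commutator G a b = \<one>\<^bsub>G\<^esub>" using C ab' by simp
    moreover have "a \<otimes>\<^bsub>G\<^esub> b = commutator G a b \<otimes>\<^bsub>G\<^esub> (b \<otimes>\<^bsub>G\<^esub> a)"
      using aG by (simp add: G.word_simps)
    ultimately show ?thesis using aG by simp
  qed
  show "enat n \<le> palindromic_width G Y"
  proof -
    interpret V: comm_group "parity_group :: nat set monoid" by (rule comm_group_parity_group)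
    obtain \<psi> :: "'a \<Rightarrow> nat set" where \<psi>: "\<psi> \<in> hom F parity_group" "\<And>i. i \<in> {1..n} \<Longrightarrow> \<psi> (x i) = {i}"
      using free_basis_universal[OF F V.is_group, of "\<lambda>i. {i}"] by auto
    interpret \<psi>: group_hom F parity_group \<psi> using \<psi>(1) by unfold_locales
    have "K \<subseteq> kernel F parity_group \<psi>"
      unfolding K_derived
      by (rule \<psi>.derived_in_kernel[OF V.comm_group_axioms F.lower_central_in_carrier])
    then obtain \<psi>1 where \<psi>1: "\<psi>1 \<in> hom AN parity_group" "\<And>g. g \<in> carrier F \<Longrightarrow> \<psi>1 (?\<kappa> g) = \<psi> g"
      using \<psi>.FactGroup_universal_kernel[OF K.normal_axioms] unfolding AN by blast
    interpret \<psi>1: group_hom AN parity_group \<psi>1 using \<psi>1(1) by unfold_locales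
    have "?sq \<subseteq> kernel AN parity_group \<psi>1"
    proof
      fix s assume "s \<in> ?sq"
      then obtain a where a: "a \<in> carrier AN" "s = a \<otimes>\<^bsub>AN\<^esub> a"
        using XC by (auto simp: numeral_2_eq_2)
      then have "\<psi>1 s = {}" by simp
      then show "s \<in> kernel AN parity_group \<psi>1" using a by (simp add: kernel_def)
    qed
    then have "S \<subseteq> kernel AN parity_group \<psi>1"
      unfolding S by (rule \<psi>1.normal_closure_in_kernel)
    then obtain \<psi>2 where \<psi>2: "\<psi>2 \<in> hom G parity_group" "\<And>a. a \<in> carrier AN \<Longrightarrow> \<psi>2 (?\<sigma> a) = \<psi>1 a"
      using \<psi>1.FactGroup_universal_kernel[OF S.normal_axioms] unfolding G by blast
    have "\<psi>2 (y i) = {i}" if "i \<in> {1..n}" for i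
    proof -
      have "x i \<in> carrier F" using that xF by blast
      then show ?thesis
        unfolding y_def \<phi>_def using \<psi>2(2)[OF \<kappa>.hom_closed] \<psi>1(2) \<psi>(2)[OF that] by simp
    qed
    then have "enat (card {1..n}) \<le> palindromic_width G (y ` {1..n})"
      by (intro G.palindromic_width_ge_parity[OF \<psi>2(1) yC]) (use inv in auto)
    then show ?thesis by (simp add: Y)
  qed
  show "palindromic_width G Y \<le> enat (2 * n)"
  proof (rule palindromic_width_le)
    fix g assume g: "g \<in> carrier G"
    define ys where "ys = map y [1..<Suc n]"
    have ys: "set ys = y ` {1..n}" "length ys = n"
      by (simp_all add: ys_def atLeastLessThanSuc_atLeastAtMost del: upt_Suc)
    obtain ps where ps: "set ps \<subseteq> {u \<otimes>\<^bsub>G\<^esub> z \<otimes>\<^bsub>G\<^esub> inv\<^bsub>G\<^esub> u | u z. u \<in> carrier G \<and> z \<in> set ys}"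
        "length ps \<le> 2 * length ys" "g = foldr (\<otimes>\<^bsub>G\<^esub>) ps \<one>\<^bsub>G\<^esub>"
      using G.product_of_involution_conjugates[of ys c, OF _ _ _ abelian g] gen yC inv
      unfolding ys by blast
    have "set ps \<subseteq> palindromes G Y"
    proof
      fix p assume "p \<in> set ps"
      then obtain u z where "u \<in> carrier G" "z \<in> y ` {1..n}" "p = u \<otimes>\<^bsub>G\<^esub> z \<otimes>\<^bsub>G\<^esub> inv\<^bsub>G\<^esub> u"
        using ps(1) unfolding ys by blast
      then show "p \<in> palindromes G Y"
        unfolding Y using G.conjugates_are_palindromes[OF gen yC inv] by blast
    qed
    then show "\<exists>ps. set ps \<subseteq> palindromes G Y \<and> length ps \<le> 2 * n \<and> g = foldr (\<otimes>\<^bsub>G\<^esub>) ps \<one>\<^bsub>G\<^esub>"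
      using ps(2,3) ys(2) by auto
  qed
qed

lemma (in group) metab_kernel_eq_ab_nilp_kernel: "metab_kernel G = ab_nilp_kernel G 1"
  by (simp add: metab_kernel_def ab_nilp_kernel_def derived_eq_lower_central)

text \<open>The metabelian case is the case \<open>c = 1\<close>, and \<open>2n \<le> 3n - 1\<close> for \<open>n \<ge> 1\<close>.\<close>

theorem theorem1p4:
  fixes F :: "('a, 'b) monoid_scheme" and n :: nat and x :: "nat \<Rightarrow> 'a"
  assumes "free_basis F {1..n} x"
  shows "(\<forall>c \<ge> 1. n \<ge> 2 \<longrightarrow>
            (let AN = F Mod ab_nilp_kernel F c;
                 X = coset_image F (ab_nilp_kernel F c) (x ` {1..n});
                 AN' = AN Mod squares_closure AN X;
                 Y = coset_image AN (squares_closure AN X) X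
             in enat n \<le> palindromic_width AN' Y \<and> palindromic_width AN' Y \<le> enat (3 * n)))
       \<and> (n \<ge> 1 \<longrightarrow>
            (let M = F Mod metab_kernel F;
                 X = coset_image F (metab_kernel F) (x ` {1..n});
                 M' = M Mod squares_closure M X;
                 Y = coset_image M (squares_closure M X) X
             in enat n \<le> palindromic_width M' Y \<and> palindromic_width M' Y \<le> enat (3 * n - 1)))"
proof -
  interpret group F using assms by (simp add: free_basis_def)
  note bounds = palindromic_width_involution_quotient[OF assms]
  have weaken: "a \<le> enat m" if "a \<le> enat (2 * n)" "2 * n \<le> m" for a m
    by (rule order_trans[OF that(1)]) (use that(2) in simp)
  show ?thesis
    unfolding Let_def metab_kernel_eq_ab_nilp_kernel
    by (intro conjI allI impI) (rule bounds(1) | rule weaken[OF bounds(2)], simp)+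
qed

end
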